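(* Let $\mathsf{M}$ be a matroid of rank $r$ on $[n]$. Then \[ \operatorname{Hilb}\Big(\operatorname{Tor}_{\bullet}^{S_{\mathsf{M}}}\big(\mathbb{C}[\Sigma_{\mathsf{M},\emptyset}]\big)_{\bullet}\Big)-1=x(1+x)^{n-r}y^{r-1}\,T_{\mathsf{M}}\Big(1,\frac{1}{1+x}\Big). \]
   Context: For a basis $B$ of $\mathsf{M}$ and $x\notin B$, $C_{B\cup x}$ is the unique circuit in $B\cup x$; $x$ is externally active if $x=\min C_{B\cup x}$. An element $x\in B$ is internally active if it is externally active with respect to the basis $[n]\setminus B$ of the dual matroid $\mathsf{M}^*$ (whose bases are complements of bases of $\mathsf{M}$). $\mathrm{ea}(B),\mathrm{ia}(B)$ count these; the Tutte polynomial is $T_{\mathsf{M}}(x,y)=\sum_B x^{\mathrm{ia}(B)}y^{\mathrm{ea}(B)}$. $S_{\mathsf{M}}=\mathbb{C}[x_1,\dots,x_n]$ and $\mathbb{C}[\Sigma_{\mathsf{M},\emptyset}]=S_{\mathsf{M}}/\langle\prod_{i\in B}x_i: B\text{ basis}\rangle$, graded by polynomial degree. With $V=\mathrm{span}(x_1,\dots,x_n)$ and graded module $A=\bigoplus_sA_s$, the Koszul complex $A\otimes\bigwedge^\bullet V$ has $d(a\otimes\ell_1\wedge\cdots\wedge\ell_t)=\sum_j(-1)^j(\ell_ja)\otimes\ell_1\wedge\cdots\widehat{\ell_j}\cdots\wedge\ell_t$; $\operatorname{Tor}^{S_{\mathsf{M}}}_t(A)_s$ is its homology at $A_s\otimes\bigwedge^tV$,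 and $\operatorname{Hilb}=\sum_{t,s}\dim\operatorname{Tor}_t(A)_s\,x^ty^s$.
   Formalization: The rank r is assumed to be at least 1; for r = 0 the ideal is the unit ideal, so the left side is -1 while the right side is x/y, and the identity fails. *)

theory Defs
  imports
    "HOL-Library.Poly_Mapping"
    "HOL-Algebra.QuotRing"
    "HOL-Computational_Algebra.Formal_Power_Series"
    "Jordan_Normal_Form.VS_Connect"
begin

hide_const (open) Multiset.mult Polynomial.smult

section \<open>Matroids on \<open>{1..n}\<close> and the Tutte polynomial\<close>

text \<open>A matroid is given by its set of bases.\<close>

definition matroid_on :: "nat \<Rightarrow> nat set set \<Rightarrow> bool" where
  "matroid_on n \<B> \<longleftrightarrow> \<B> \<subseteq> Pow {1..n} \<and> \<B> \<noteq> {} \<and>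
    (\<forall>A\<in>\<B>. \<forall>B\<in>\<B>. \<forall>a\<in>A - B. \<exists>b\<in>B - A. insert b (A - {a}) \<in> \<B>)"

definition matroid_rank :: "nat set set \<Rightarrow> nat" where
  "matroid_rank \<B> = (THE r. \<forall>B\<in>\<B>. card B = r)"

definition indep :: "nat set set \<Rightarrow> nat set \<Rightarrow> bool" where
  "indep \<B> I \<longleftrightarrow> (\<exists>B\<in>\<B>. I \<subseteq> B)"

definition circuit :: "nat \<Rightarrow> nat set set \<Rightarrow> nat set \<Rightarrow> bool" where
  "circuit n \<B> C \<longleftrightarrow> C \<subseteq> {1..n} \<and> \<not> indep \<B> C \<and> (\<forall>D. D \<subset> C \<longrightarrow> indep \<B> D)"

definition fund_circuit :: "nat \<Rightarrow> nat set set \<Rightarrow> nat set \<Rightarrow> nat \<Rightarrow> nat set" where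
  "fund_circuit n \<B> B x = (THE C. circuit n \<B> C \<and> C \<subseteq> insert x B)"

definition dual_bases :: "nat \<Rightarrow> nat set set \<Rightarrow> nat set set" where
  "dual_bases n \<B> = (\<lambda>B. {1..n} - B) ` \<B>"

definition ext_active :: "nat \<Rightarrow> nat set set \<Rightarrow> nat set \<Rightarrow> nat \<Rightarrow> bool" where
  "ext_active n \<B> B x \<longleftrightarrow> x \<in> {1..n} - B \<and> x = Min (fund_circuit n \<B> B x)"

definition int_active :: "nat \<Rightarrow> nat set set \<Rightarrow> nat set \<Rightarrow> nat \<Rightarrow> bool" where
  "int_active n \<B> B x \<longleftrightarrow> x \<in> B \<and> ext_active n (dual_bases n \<B>) ({1..n} - B) x"

definition ext_activity :: "nat \<Rightarrow> nat set set \<Rightarrow> nat set \<Rightarrow> nat" where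
  "ext_activity n \<B> B = card {x. ext_active n \<B> B x}"

definition int_activity :: "nat \<Rightarrow> nat set set \<Rightarrow> nat set \<Rightarrow> nat" where
  "int_activity n \<B> B = card {x. int_active n \<B> B x}"

text \<open>The Tutte polynomial, evaluated at a pair of elements of an arbitrary commutative semiring.\<close>

definition tutte :: "nat \<Rightarrow> nat set set \<Rightarrow> 'a::comm_semiring_1 \<Rightarrow> 'a \<Rightarrow> 'a" where
  "tutte n \<B> x y = (\<Sum>B\<in>\<B>. x ^ int_activity n \<B> B * y ^ ext_activity n \<B> B)"


section \<open>The polynomial ring and graded pieces\<close>

text \<open>Elements of \<open>cpoly\<close> are complex polynomials in variables indexed by all naturals;
  the ring in \<open>n\<close> variables is cut out by its carrier.\<close>

type_synonym cpoly = "(nat \<Rightarrow>\<^sub>0 nat) \<Rightarrow>\<^sub>0 complex"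

definition X :: "nat \<Rightarrow> cpoly" where
  "X i = Poly_Mapping.single (Poly_Mapping.single i 1) 1"

definition Const :: "complex \<Rightarrow> cpoly" where
  "Const c = Poly_Mapping.single 0 c"

definition poly_ring :: "nat \<Rightarrow> cpoly ring" where
  "poly_ring n =
    \<lparr>carrier = {p. \<forall>m\<in>Poly_Mapping.keys p. Poly_Mapping.keys m \<subseteq> {1..n}},
     mult = (*), one = 1, zero = 0, add = (+)\<rparr>"

definition homogeneous :: "nat \<Rightarrow> cpoly \<Rightarrow> bool" where
  "homogeneous s p \<longleftrightarrow>
    (\<forall>m\<in>Poly_Mapping.keys p. (\<Sum>i\<in>Poly_Mapping.keys m. Poly_Mapping.lookup m i) = s)"

definition basis_ideal :: "nat \<Rightarrow> nat set set \<Rightarrow> cpoly set" where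
  "basis_ideal n \<B> = Idl\<^bsub>poly_ring n\<^esub> {\<Prod>i\<in>B. X i | B. B \<in> \<B>}"

text \<open>The quotient ring of the polynomial ring by \<open>basis_ideal\<close>, as a module over the
  polynomial ring, and its graded pieces.\<close>

definition face_ring :: "nat \<Rightarrow> nat set set \<Rightarrow> cpoly set ring" where
  "face_ring n \<B> = poly_ring n Quot basis_ideal n \<B>"

definition face_module :: "nat \<Rightarrow> nat set set \<Rightarrow> (cpoly, cpoly set) module" where
  "face_module n \<B> =
    \<lparr>carrier = carrier (face_ring n \<B>), mult = mult (face_ring n \<B>),
     one = one (face_ring n \<B>), zero = zero (face_ring n \<B>), add = add (face_ring n \<B>),
     smult = (\<lambda>p a. (basis_ideal n \<B> +>\<^bsub>poly_ring n\<^esub> p) \<otimes>\<^bsub>face_ring n \<B>\<^esub> a)\<rparr>"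

definition face_piece :: "nat \<Rightarrow> nat set set \<Rightarrow> nat \<Rightarrow> cpoly set set" where
  "face_piece n \<B> s =
    {basis_ideal n \<B> +>\<^bsub>poly_ring n\<^esub> p | p. p \<in> carrier (poly_ring n) \<and> homogeneous s p}"


section \<open>The Koszul complex and Tor\<close>

text \<open>Let \<open>A\<close> be a module over \<open>poly_ring n\<close> with graded pieces \<open>gr s\<close>. For
  \<open>J = {l\<^sub>1 < \<dots> < l\<^sub>t}\<close> the wedges \<open>e\<^sub>J = X l\<^sub>1 \<and> \<dots> \<and> X l\<^sub>t\<close> form a basis of the exterior
  algebra of the span of the variables, so an element of the Koszul complex is written
  uniquely as the sum of \<open>f J \<otimes> e\<^sub>J\<close> and is represented by \<open>f\<close>, with value \<open>\<zero>\<close> at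
  every set that does not index a basis vector of exterior degree \<open>t\<close>.
  The first record below is the complex vector space in module degree \<open>s\<close> and
  exterior degree \<open>t\<close>; the fields \<open>mult\<close> and \<open>one\<close> play no role in a module.\<close>

definition koszul_space ::
  "nat \<Rightarrow> (cpoly, 'a) module \<Rightarrow> (nat \<Rightarrow> 'a set) \<Rightarrow> nat \<Rightarrow> nat \<Rightarrow> (complex, nat set \<Rightarrow> 'a) module"
  where
  "koszul_space n A gr s t =
    \<lparr>carrier = {f. \<forall>J. f J \<in> (if J \<subseteq> {1..n} \<and> card J = t then gr s else {\<zero>\<^bsub>A\<^esub>})},
     mult = undefined, one = undefined, zero = (\<lambda>J. \<zero>\<^bsub>A\<^esub>),
     add = (\<lambda>f g J. f J \<oplus>\<^bsub>A\<^esub> g J),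
     smult = (\<lambda>c f J. Const c \<odot>\<^bsub>A\<^esub> f J)\<rparr>"

text \<open>The coefficient of \<open>d f\<close> at \<open>e\<^sub>J\<close> collects, for every \<open>i\<close> outside \<open>J\<close>, the term of
  \<open>d (f (J \<union> {i}) \<otimes> e\<^bsub>J \<union> {i}\<^esub>)\<close> in which \<open>X i\<close> is omitted; its sign exponent is
  the position, counted from 1, of \<open>i\<close> in \<open>J \<union> {i}\<close>.\<close>

definition koszul_d :: "nat \<Rightarrow> (cpoly, 'a) module \<Rightarrow> (nat set \<Rightarrow> 'a) \<Rightarrow> (nat set \<Rightarrow> 'a)" where
  "koszul_d n A f = (\<lambda>J. \<Oplus>\<^bsub>A\<^esub>i\<in>{1..n} - J.
     ((-1) ^ (card {j\<in>J. j < i} + 1) * X i) \<odot>\<^bsub>A\<^esub> f (insert i J))"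

definition koszul_cycles ::
  "nat \<Rightarrow> (cpoly, 'a) module \<Rightarrow> (nat \<Rightarrow> 'a set) \<Rightarrow> nat \<Rightarrow> nat \<Rightarrow> (nat set \<Rightarrow> 'a) set" where
  "koszul_cycles n A gr s t =
    {f \<in> carrier (koszul_space n A gr s t). koszul_d n A f = (\<lambda>J. \<zero>\<^bsub>A\<^esub>)}"

text \<open>The differential lowers \<open>t\<close> and raises \<open>s\<close> by one; there is nothing in degree \<open>s = -1\<close>.\<close>

definition koszul_boundaries ::
  "nat \<Rightarrow> (cpoly, 'a) module \<Rightarrow> (nat \<Rightarrow> 'a set) \<Rightarrow> nat \<Rightarrow> nat \<Rightarrow> (nat set \<Rightarrow> 'a) set" where
  "koszul_boundaries n A gr s t =
    (case s of 0 \<Rightarrow> {\<lambda>J. \<zero>\<^bsub>A\<^esub>}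
     | Suc s' \<Rightarrow> koszul_d n A ` carrier (koszul_space n A gr s' (Suc t)))"

definition quot_module :: "('c, 'b) module \<Rightarrow> 'b set \<Rightarrow> ('c, 'b set) module" where
  "quot_module M N =
    \<lparr>carrier = a_rcosets\<^bsub>M\<^esub> N, mult = undefined, one = undefined, zero = N, add = set_add M,
     smult = (\<lambda>c C. \<Union>v\<in>C. N +>\<^bsub>M\<^esub> (c \<odot>\<^bsub>M\<^esub> v))\<rparr>"

definition Tor ::
  "nat \<Rightarrow> (cpoly, 'a) module \<Rightarrow> (nat \<Rightarrow> 'a set) \<Rightarrow> nat \<Rightarrow> nat \<Rightarrow> (complex, (nat set \<Rightarrow> 'a) set) module"
  where
  "Tor n A gr t s =
    quot_module (koszul_space n A gr s t\<lparr>carrier := koszul_cycles n A gr s t\<rparr>)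
      (koszul_boundaries n A gr s t)"

text \<open>The outer power series variable is \<open>y\<close>, the inner one is \<open>x\<close>.\<close>

definition Tor_Hilb :: "nat \<Rightarrow> (cpoly, 'a) module \<Rightarrow> (nat \<Rightarrow> 'a set) \<Rightarrow> rat fps fps" where
  "Tor_Hilb n A gr =
    Abs_fps (\<lambda>s. Abs_fps (\<lambda>t. of_nat (vectorspace.dim class_ring (Tor n A gr t s))))"

end

theory Submission
  imports Defs
begin

text \<open>Order the bases by decreasing value of \<open>\<Sum>b\<in>B. 2 ^ b\<close>. The basis ideal then has linear
  quotients: the colon ideal at the step of \<open>B\<close> is generated by the variables of the externally
  passive elements of \<open>B\<close>. Hence every monomial \<open>m\<close> of the ideal factors through the heaviest
  basis \<open>B\<close> dividing it, with a cofactor that avoids the passive elements of \<open>B\<close>. On the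
  Koszul cells \<open>m \<otimes> e\<^sub>J\<close> with \<open>m\<close> in the ideal, toggling the smallest non-passive element of
  the cofactor or of \<open>J\<close> is a matching with respect to which the differential is triangular for
  the weight. The unmatched cells are \<open>x\<^sub>B \<otimes> e\<^sub>J\<close> with \<open>J\<close> consisting of passive elements, all
  in polynomial degree \<open>r\<close>, so they count the homology of the ideal. The connecting map
  \<open>f \<mapsto> d f\<close> carries this over to the quotient ring in polynomial degree \<open>r - 1\<close>; and
  \<open>B\<close> has \<open>n - r - ea B\<close> passive elements.\<close>

section \<open>Bases of a matroid\<close>

text \<open>The weight reads a basis as a binary numeral, so two bases compare by the largest
  element in which they differ, and replacing \<open>b\<close> by a larger \<open>i\<close> always
  increases the weight. Hence \<open>i\<close> is externally passive exactly when some such swap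
  leads to a heavier basis; this is why the minimum in the definition of external activity goes with
  an order by decreasing weight. The Koszul complex of the whole polynomial ring is exact in
  positive total degree. There the connecting map is an isomorphism that lowers the exterior degree
  and raises the polynomial degree by one: the origin of the factor \<open>x\<close> and of the
  exponent \<open>r - 1\<close>. Total degree 0 contributes the subtracted 1. All critical cells
  share one polynomial degree while the differential changes it, so no differential runs between
  them and their number is the dimension itself, not only an upper bound. The definitions supply
  bare records of cosets; dimensions are therefore found from linear functionals that cut out the
  boundaries among the cycles.\<close>

definition bin_weight :: "nat set \<Rightarrow> nat" where
  "bin_weight A = (\<Sum>a\<in>A. 2 ^ a)"

lemma bin_weight_below: "finite A \<Longrightarrow> A \<subseteq> {..<j} \<Longrightarrow> bin_weight A < 2 ^ j"
  using sum_mono2[of "{..<j}" A "\<lambda>a. (2::nat) ^ a"] sum_power2[of j]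
  by (simp add: bin_weight_def lessThan_atLeast0)
    (metis (no_types, lifting) Suc_pred le_imp_less_Suc pos2 zero_less_power)

text \<open>After the common part is cancelled, what remains of \<open>A\<close> has only binary
  digits below \<open>j\<close> and sums to less than \<open>2 ^ j\<close>, while \<open>B\<close>
  still has the digit \<open>j\<close>.\<close>

lemma bin_weight_less:
  assumes "finite A" "finite B" "j \<in> B - A" "\<And>i. i \<in> (A - B) \<union> (B - A) \<Longrightarrow> i \<le> j"
  shows "bin_weight A < bin_weight B"
proof -
  have eq: "bin_weight S = bin_weight (A \<inter> B) + bin_weight (S - A \<inter> B)"
    if "finite S" "A \<inter> B \<subseteq> S" for S
    unfolding bin_weight_def using sum.subset_diff[OF that(2,1), of "\<lambda>a. (2::nat) ^ a"] by simp
  have "A - A \<inter> B \<subseteq> {..<j}"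
    using assms(3,4) by (metis (no_types, lifting) Diff_Diff_Int Diff_iff IntI UnI1 lessThan_iff
        nat_less_le subsetI)
  then have "bin_weight (A - A \<inter> B) < 2 ^ j"
    using bin_weight_below assms(1) by blast
  also have "\<dots> \<le> bin_weight (B - A \<inter> B)"
    unfolding bin_weight_def using assms(2,3) by (intro member_le_sum) auto
  finally show ?thesis
    using eq[of A] eq[of B] assms(1,2) by auto
qed

locale based_matroid =
  fixes n :: nat and \<B> :: "nat set set"
  assumes matroid: "matroid_on n \<B>"
begin

lemma basis_subset: "B \<in> \<B> \<Longrightarrow> B \<subseteq> {1..n}"
  using matroid by (auto simp: matroid_on_def)

lemma finite_basis: "B \<in> \<B> \<Longrightarrow> finite B"
  using basis_subset finite_subset by blast

lemma finite_bases: "finite \<B>"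
  using basis_subset by (meson PowI finite_Pow_iff finite_atLeastAtMost finite_subset subsetI)

lemma bases_nonempty: "\<B> \<noteq> {}"
  using matroid by (simp add: matroid_on_def)

lemma exchange:
  "A \<in> \<B> \<Longrightarrow> B \<in> \<B> \<Longrightarrow> a \<in> A - B \<Longrightarrow> \<exists>b\<in>B - A. insert b (A - {a}) \<in> \<B>"
  using matroid by (simp add: matroid_on_def)

text \<open>Exchanging the elements of \<open>A - B\<close> one at a time keeps the cardinality and
  ends in a basis contained in \<open>B\<close>.\<close>

lemma card_basis_le: "A \<in> \<B> \<Longrightarrow> B \<in> \<B> \<Longrightarrow> card A \<le> card B"
proof (induction "card (A - B)" arbitrary: A)
  case 0
  then have "A \<subseteq> B" using finite_basis by auto
  then show ?case using finite_basis[OF 0(3)] card_mono by blast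
next
  case (Suc k)
  then obtain a where a: "a \<in> A - B" by (metis card_eq_SucD insertI1)
  then obtain b where b: "b \<in> B - A" "insert b (A - {a}) \<in> \<B>"
    using exchange Suc.prems by blast
  have "insert b (A - {a}) - B = (A - B) - {a}" using b by auto
  then have "card (insert b (A - {a}) - B) = k"
    using Suc.hyps(2) a finite_basis[OF Suc.prems(1)] by simp
  then have "card (insert b (A - {a})) \<le> card B"
    using Suc b by metis
  then show ?case
    using a b finite_basis[OF Suc.prems(1)]
    by (simp add: card_insert_if)
qed

lemma card_basis: "B \<in> \<B> \<Longrightarrow> card B = matroid_rank \<B>"
proof -
  assume B: "B \<in> \<B>"
  have "\<forall>A\<in>\<B>. card A = card B"
    using card_basis_le B by (meson antisym)
  then show "card B = matroid_rank \<B>"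
    unfolding matroid_rank_def using B by (intro the_equality[symmetric]) metis+
qed

lemma basis_subset_eq: "A \<in> \<B> \<Longrightarrow> B \<in> \<B> \<Longrightarrow> A \<subseteq> B \<Longrightarrow> A = B"
  by (rule card_subset_eq) (simp_all add: finite_basis card_basis)

text \<open>Exchange against \<open>B\<close> is applied only to elements outside
  \<open>I \<union> B\<close> and brings in only elements of \<open>B\<close>, so \<open>I\<close>
  survives until the basis lies in \<open>I \<union> B\<close>.\<close>

lemma augment:
  assumes "indep \<B> I" "B \<in> \<B>"
  shows "\<exists>A\<in>\<B>. I \<subseteq> A \<and> A \<subseteq> I \<union> B"
proof -
  have "\<exists>A'\<in>\<B>. I \<subseteq> A' \<and> A' \<subseteq> I \<union> B" if "A \<in> \<B>" "I \<subseteq> A" for A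
    using that
  proof (induction "card (A - (I \<union> B))" arbitrary: A)
    case 0
    then have "A \<subseteq> I \<union> B" using finite_basis[OF 0(2)] by auto
    then show ?case using 0 by blast
  next
    case (Suc k)
    then obtain a where a: "a \<in> A - (I \<union> B)" by (metis card_eq_SucD insertI1)
    then obtain b where b: "b \<in> B - A" "insert b (A - {a}) \<in> \<B>"
      using exchange[of A B a] Suc.prems assms(2) by blast
    have "insert b (A - {a}) - (I \<union> B) = (A - (I \<union> B)) - {a}" using b by auto
    then have "card (insert b (A - {a}) - (I \<union> B)) = k"
      using Suc.hyps(2) a finite_basis[OF Suc.prems(1)] by simp
    moreover have "I \<subseteq> insert b (A - {a})" using a Suc.prems by auto
    ultimately show ?case using Suc.hyps(1)[of "insert b (A - {a})"] b by auto
  qed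
  then show ?thesis using assms(1) by (auto simp: indep_def)
qed

text \<open>The exchange axiom prescribes the leaving element, here the entering one is prescribed.
  Augmenting \<open>insert j (A \<inter> B)\<close> from \<open>B\<close> gives a basis whose only
  element outside \<open>B\<close> is \<open>j\<close>; it lacks a single element of
  \<open>B\<close>, and that one is not in \<open>A\<close>.\<close>

lemma dual_exchange:
  assumes "A \<in> \<B>" "B \<in> \<B>" "j \<in> A - B"
  shows "\<exists>b\<in>B - A. insert j (B - {b}) \<in> \<B>"
proof -
  have "indep \<B> (insert j (A \<inter> B))"
    using assms by (auto simp: indep_def)
  then obtain C where C: "C \<in> \<B>" "insert j (A \<inter> B) \<subseteq> C" "C \<subseteq> insert j (A \<inter> B) \<union> B"
    using augment assms(2) by blast
  have fin: "finite B" "finite C" using finite_basis C assms by auto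
  have "card (B - C) = card (C - B)"
    using card_basis[OF C(1)] card_basis[OF assms(2)] fin
    by (simp add: card_Diff_subset_Int Int_commute)
  also have "C - B = {j}" using C assms by auto
  finally obtain b where b: "B - C = {b}" by (auto simp: card_1_singleton_iff)
  then have "C = insert j (B - {b})" using C assms(3) by auto
  then show ?thesis using b C by blast
qed

subsection \<open>Passive elements and fundamental circuits\<close>

text \<open>For a basis these are the elements that are not the minimum of their fundamental
  circuit, phrased through the swap that makes \<open>B\<close> heavier.\<close>

definition passives :: "nat set \<Rightarrow> nat set" where
  "passives B = {i \<in> {1..n} - B. \<exists>b\<in>B. b < i \<and> insert i (B - {b}) \<in> \<B>}"

lemma passives_subset: "passives B \<subseteq> {1..n} - B"
  by (auto simp: passives_def)

lemma finite_passives: "finite (passives B)"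
  using passives_subset finite_subset by blast

text \<open>A subset missing an exchangeable \<open>y\<close> lies in a basis. Conversely, were the
  set of exchangeable elements independent, a basis between it and \<open>insert x B\<close> would
  miss a single \<open>y\<close>, which would then be exchangeable. So this set is the least
  dependent subset of \<open>insert x B\<close>, which settles both halves of the
  \<open>THE\<close>.\<close>

lemma fund_circuit_eq:
  assumes B: "B \<in> \<B>" and x: "x \<in> {1..n} - B"
  shows "fund_circuit n \<B> B x = {y \<in> insert x B. insert x B - {y} \<in> \<B>}" (is "_ = ?C")
proof -
  define C where "C = ?C"
  have xC: "x \<in> C" using B x by (simp add: C_def)
  have CB: "C \<subseteq> insert x B" by (auto simp: C_def)
  have indepI: "indep \<B> D" if "D \<subseteq> insert x B" "y \<in> C" "y \<notin> D" for y D
    using that by (auto simp: indep_def C_def intro!: bexI[of _ "insert x B - {y}"])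
  have dep: "\<not> indep \<B> C"
  proof
    assume "indep \<B> C"
    then obtain A where A: "A \<in> \<B>" "C \<subseteq> A" "A \<subseteq> C \<union> B" using augment B by metis
    then have AB: "A \<subseteq> insert x B" using CB by auto
    have fin: "finite B" using finite_basis B by auto
    have "card (insert x B - A) = 1"
      using card_basis[OF A(1)] card_basis[OF B] fin AB x finite_basis[OF A(1)]
      by (simp add: card_Diff_subset)
    then obtain y where y: "insert x B - A = {y}" by (auto simp: card_1_singleton_iff)
    then have "insert x B - {y} = A" using AB by auto
    then have "y \<in> C" using A(1) y by (auto simp: C_def)
    then show False using A(2) y by auto
  qed
  have circ: "circuit n \<B> C"
    unfolding circuit_def
  proof (intro conjI allI impI)
    show "C \<subseteq> {1..n}" using x basis_subset[OF B] CB by auto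
    show "\<not> indep \<B> C" by (fact dep)
    fix D assume "D \<subset> C"
    then obtain y where "y \<in> C" "y \<notin> D" "D \<subseteq> insert x B" using CB by auto
    then show "indep \<B> D" using indepI by metis
  qed
  have uniq: "D = C" if D: "circuit n \<B> D" "D \<subseteq> insert x B" for D
  proof -
    have "C \<subseteq> D"
    proof
      fix y assume "y \<in> C"
      then show "y \<in> D" using indepI[OF D(2)] D(1) by (auto simp: circuit_def)
    qed
    then show ?thesis using D(1) dep by (auto simp: circuit_def)
  qed
  show ?thesis
    unfolding fund_circuit_def C_def[symmetric]
  proof (rule the_equality)
    show "circuit n \<B> C \<and> C \<subseteq> insert x B" using circ CB by simp
    show "D = C" if "circuit n \<B> D \<and> D \<subseteq> insert x B" for D
      by (rule uniq) (use that in simp_all)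
  qed
qed

text \<open>\<open>x\<close> lies on its own circuit, so it fails to be the minimum only through a
  smaller \<open>b\<close> that can be swapped out.\<close>

lemma ext_active_iff:
  assumes B: "B \<in> \<B>"
  shows "ext_active n \<B> B x \<longleftrightarrow> x \<in> {1..n} - B - passives B"
proof (cases "x \<in> {1..n} - B")
  case x: True
  let ?C = "{y \<in> insert x B. insert x B - {y} \<in> \<B>}"
  have fin: "finite ?C" using finite_basis[OF B] by simp
  have xC: "x \<in> ?C" using x B by simp
  have eq: "insert x (B - {b}) = insert x B - {b}" if "b \<in> B" for b using that x by auto
  have "x = Min ?C \<longleftrightarrow> (\<forall>y\<in>?C. x \<le> y)"
    using fin xC by (metis (no_types, lifting) Min_eqI Min_le)
  also have "\<dots> \<longleftrightarrow> x \<notin> passives B"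
    using x eq by (auto simp: passives_def not_less) 
  finally show ?thesis using x by (simp add: ext_active_def fund_circuit_eq[OF B x])
qed (auto simp: ext_active_def)

text \<open>Used at the end to trade powers of \<open>1 / (1 + x)\<close> for powers of
  \<open>1 + x\<close>.\<close>

lemma card_passives:
  assumes B: "B \<in> \<B>"
  shows "card (passives B) + ext_activity n \<B> B = n - matroid_rank \<B>"
proof -
  have "{x. ext_active n \<B> B x} = {1..n} - B - passives B"
    unfolding ext_active_iff[OF B] by (rule Collect_mem_eq)
  then have "card (passives B) + ext_activity n \<B> B = card ({1..n} - B)"
    using card_Diff_subset[OF finite_passives passives_subset, of B]
      card_mono[OF _ passives_subset, of B] by (simp add: ext_activity_def)
  also have "\<dots> = n - matroid_rank \<B>"
    using card_basis[OF B] basis_subset[OF B] finite_basis[OF B] by (simp add: card_Diff_subset)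
  finally show ?thesis .
qed

subsection \<open>The heaviest basis in a spanning set\<close>

text \<open>The combinatorial form of divisibility: a monomial in the variables \<open>1..n\<close>
  lies in the basis ideal exactly when its support is spanning.\<close>

definition spanning :: "nat set \<Rightarrow> bool" where
  "spanning T \<longleftrightarrow> (\<exists>B\<in>\<B>. B \<subseteq> T)"

definition best :: "nat set \<Rightarrow> nat set" where
  "best T = (ARG_MAX bin_weight B. B \<in> \<B> \<and> B \<subseteq> T)"

lemma spanning_mono: "spanning S \<Longrightarrow> S \<subseteq> T \<Longrightarrow> spanning T"
  by (auto simp: spanning_def)

lemma best_props:
  assumes "spanning T"
  shows "best T \<in> \<B>" "best T \<subseteq> T"
    "\<And>B. B \<in> \<B> \<Longrightarrow> B \<subseteq> T \<Longrightarrow> bin_weight B \<le> bin_weight (best T)"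
proof -
  obtain B where B: "B \<in> \<B> \<and> B \<subseteq> T" using assms by (auto simp: spanning_def)
  have bd: "\<forall>y. y \<in> \<B> \<and> y \<subseteq> T \<longrightarrow> bin_weight y < Suc (Max (bin_weight ` \<B>))"
    using finite_bases by (simp add: le_imp_less_Suc)
  have *: "(best T \<in> \<B> \<and> best T \<subseteq> T) \<and>
      (\<forall>B. B \<in> \<B> \<and> B \<subseteq> T \<longrightarrow> bin_weight B \<le> bin_weight (best T))"
    unfolding best_def by (rule arg_max_nat_lemma[OF B bd])
  then show "best T \<in> \<B>" "best T \<subseteq> T"
    "\<And>B. B \<in> \<B> \<Longrightarrow> B \<subseteq> T \<Longrightarrow> bin_weight B \<le> bin_weight (best T)" by auto
qed

text \<open>The largest element \<open>j\<close> of the symmetric difference must belong to the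
  heavier basis \<open>B\<close>; moving it into \<open>A\<close> expels some smaller
  \<open>b\<close>. So a single swap, with the new element taken from \<open>B\<close>, already
  improves \<open>A\<close>.\<close>

lemma weight_exchange:
  assumes "A \<in> \<B>" "B \<in> \<B>" "A \<noteq> B" "bin_weight A \<le> bin_weight B"
  obtains j b where "j \<in> B - A" "b \<in> A - B" "b < j" "insert j (A - {b}) \<in> \<B>"
    "bin_weight A < bin_weight (insert j (A - {b}))"
proof -
  let ?S = "(A - B) \<union> (B - A)"
  have fin: "finite A" "finite B" using assms finite_basis by auto
  have "?S \<noteq> {}" using assms by auto
  define j where "j = Max ?S"
  have jS: "j \<in> ?S" unfolding j_def using fin \<open>?S \<noteq> {}\<close> by (intro Max_in) auto
  have jmax: "i \<le> j" if "i \<in> ?S" for i unfolding j_def using fin that by simp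
  have "j \<notin> A - B"
    using bin_weight_less[of B A j] fin jmax assms(4) by fastforce
  with jS have j: "j \<in> B - A" by blast
  obtain b where b: "b \<in> A - B" "insert j (A - {b}) \<in> \<B>"
    using dual_exchange[OF assms(2,1) j] by blast
  have bj: "b < j" using jmax[of b] b j by (metis DiffD1 DiffD2 UnI1 le_neq_implies_less)
  have "bin_weight A < bin_weight (insert j (A - {b}))"
    by (rule bin_weight_less[of _ _ j]) (use fin j b bj in auto)
  then show ?thesis using that j b bj by blast
qed

text \<open>Ties are impossible: a swap towards a different \<open>B\<close> of at least the same
  weight stays inside \<open>T\<close> and beats \<open>best T\<close>.\<close>

lemma best_eqI:
  assumes "spanning T" "B \<in> \<B>" "B \<subseteq> T" "bin_weight (best T) \<le> bin_weight B"
  shows "best T = B"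
proof (rule ccontr)
  note bT = best_props[OF assms(1)]
  assume ne: "best T \<noteq> B"
  obtain j b where jb: "j \<in> B - best T" "b \<in> best T - B" "b < j" "insert j (best T - {b}) \<in> \<B>"
    "bin_weight (best T) < bin_weight (insert j (best T - {b}))"
    by (rule weight_exchange[OF bT(1) assms(2) ne assms(4)])
  have "insert j (best T - {b}) \<subseteq> T" using bT(2) jb(1) assms(3) by auto
  then show False using bT(3)[OF jb(4)] jb(5) by simp
qed

lemma best_mono:
  assumes "spanning S" "S \<subseteq> T"
  shows "bin_weight (best S) \<le> bin_weight (best T)"
proof (rule best_props(3)[OF spanning_mono[OF assms]])
  show "best S \<in> \<B>" "best S \<subseteq> T" using best_props[OF assms(1)] assms(2) by auto
qed

lemma best_subset_eq:
  assumes "spanning T" "best T \<subseteq> S" "S \<subseteq> T"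
  shows "spanning S" "best S = best T"
proof -
  show S: "spanning S" using best_props(1)[OF assms(1)] assms(2) by (auto simp: spanning_def)
  show "best S = best T"
    using best_eqI[OF S best_props(1)[OF assms(1)] assms(2)] best_mono[OF S assms(3)] by simp
qed

text \<open>The linear quotient property of the basis ideal, with the bases ordered by decreasing
  weight.\<close>

lemma best_insert_iff:
  assumes T: "spanning T" and i: "i \<in> {1..n}"
  shows "best (insert i T) = best T \<longleftrightarrow> i \<notin> passives (best T)"
proof
  have iT: "spanning (insert i T)" using T spanning_mono by blast
  note bT = best_props[OF T] and biT = best_props[OF iT]
  {
    assume eq: "best (insert i T) = best T"
    show "i \<notin> passives (best T)"
    proof
      assume "i \<in> passives (best T)"
      then obtain b where b: "i \<notin> best T" "b \<in> best T" "b < i" "insert i (best T - {b}) \<in> \<B>"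
        by (auto simp: passives_def)
      have "bin_weight (best T) < bin_weight (insert i (best T - {b}))"
        by (rule bin_weight_less[of _ _ i]) (use finite_basis[OF bT(1)] b in auto)
      moreover have "insert i (best T - {b}) \<subseteq> insert i T" using bT(2) by auto
      ultimately show False using biT(3)[OF b(4)] eq by fastforce
    qed
  next
    assume np: "i \<notin> passives (best T)"
    show "best (insert i T) = best T"
    proof (rule ccontr)
      assume ne: "best (insert i T) \<noteq> best T"
      obtain j b where jb: "j \<in> best (insert i T) - best T" "b \<in> best T - best (insert i T)"
        "b < j" "insert j (best T - {b}) \<in> \<B>"
        "bin_weight (best T) < bin_weight (insert j (best T - {b}))"
        by (rule weight_exchange[OF bT(1) biT(1) ne[symmetric] best_mono[OF T subset_insertI]])
      \<comment> \<open>For \<open>j = i\<close> the swap would make \<open>i\<close> passive.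
        Otherwise \<open>j\<close> already lies in \<open>T\<close>, and the swap contradicts the
        maximality of \<open>best T\<close>.\<close>
      have "j \<noteq> i" using np jb i by (auto simp: passives_def)
      then have "insert j (best T - {b}) \<subseteq> T" using jb biT(2) bT(2) by auto
      then show False using bT(3)[OF jb(4)] jb(5) by simp
    qed
  }
qed

lemma not_passive_best:
  assumes "spanning T" "i \<in> T" "i \<in> {1..n}"
  shows "i \<notin> passives (best T)"
  using best_insert_iff[OF assms(1,3)] assms(2) by (simp add: insert_absorb)

end

section \<open>The Koszul differential on coefficient functions\<close>

type_synonym expo = "nat \<Rightarrow>\<^sub>0 nat"

abbreviation unit_expo :: "nat \<Rightarrow> expo" where
  "unit_expo i \<equiv> Poly_Mapping.single i (Suc 0)"

section \<open>Exponent vectors and their degree\<close>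

definition expo_deg :: "expo \<Rightarrow> nat" where
  "expo_deg m = (\<Sum>i\<in>Poly_Mapping.keys m. Poly_Mapping.lookup m i)"

lemma expo_deg_superset:
  "finite S \<Longrightarrow> Poly_Mapping.keys m \<subseteq> S \<Longrightarrow> expo_deg m = (\<Sum>i\<in>S. Poly_Mapping.lookup m i)"
  unfolding expo_deg_def by (rule sum.mono_neutral_left) (auto simp: in_keys_iff)

lemma expo_deg_add: "expo_deg (a + b) = expo_deg a + expo_deg b"
proof -
  let ?S = "Poly_Mapping.keys a \<union> Poly_Mapping.keys b"
  have "expo_deg (a + b) = (\<Sum>i\<in>?S. Poly_Mapping.lookup (a + b) i)"
    by (rule expo_deg_superset) (simp_all add: keys_add)
  then show ?thesis
    by (simp add: lookup_add sum.distrib expo_deg_superset[of ?S a] expo_deg_superset[of ?S b])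
qed

lemma expo_deg_unit [simp]: "expo_deg (unit_expo i) = 1"
  by (simp add: expo_deg_def)

lemma keys_add_unit [simp]: "Poly_Mapping.keys (m + unit_expo i) = insert i (Poly_Mapping.keys m)"
  by (auto simp: in_keys_iff lookup_add lookup_single when_def split: if_splits)

lemma diff_unit_add [simp]: "i \<in> Poly_Mapping.keys m \<Longrightarrow> m - unit_expo i + unit_expo i = (m :: expo)"
  by (rule poly_mapping_eqI) (auto simp: in_keys_iff lookup_add lookup_minus lookup_single when_def)

lemma keys_diff_unit:
  "Poly_Mapping.keys (m - unit_expo i) =
    (if Poly_Mapping.lookup m i \<le> 1 then Poly_Mapping.keys m - {i} else Poly_Mapping.keys m)"
  by (auto simp: in_keys_iff lookup_minus lookup_single when_def split: if_splits)

lemma insert_keys_diff_unit: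
  "i \<in> Poly_Mapping.keys m \<Longrightarrow> insert i (Poly_Mapping.keys (m - unit_expo i)) = Poly_Mapping.keys m"
  by (auto simp: keys_diff_unit)

lemma expo_deg_diff_unit:
  "i \<in> Poly_Mapping.keys m \<Longrightarrow> expo_deg m = Suc (expo_deg (m - unit_expo i))"
  using expo_deg_add[of "m - unit_expo i" "unit_expo i"] by simp

text \<open>\<open>f m J\<close> is the coefficient of \<open>x^m \<otimes> e_J\<close>. Finiteness
  is not built in; it follows from the degree bounds of \<open>chain\<close>.\<close>

type_synonym cochain = "expo \<Rightarrow> nat set \<Rightarrow> complex"

definition koszul_sign :: "nat \<Rightarrow> nat set \<Rightarrow> complex" where
  "koszul_sign i J = (-1) ^ (card {j\<in>J. j < i} + 1)"

text \<open>The Koszul differential of the polynomial ring, read at its target: a term that gains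
  \<open>X i\<close> and loses \<open>i\<close> from its wedge comes from
  \<open>m - unit_expo i\<close> and \<open>insert i J\<close>. The restriction to
  \<open>keys m\<close> matters because the subtraction is truncated.\<close>

definition kd :: "nat \<Rightarrow> cochain \<Rightarrow> cochain" where
  "kd n f = (\<lambda>m J. \<Sum>i\<in>({1..n} - J) \<inter> Poly_Mapping.keys m.
     koszul_sign i J * f (m - unit_expo i) (insert i J))"

lemma koszul_sign_sq [simp]: "koszul_sign i J * koszul_sign i J = 1"
  by (simp add: koszul_sign_def power_mult_distrib[symmetric] flip: power_add mult_2)

lemma koszul_sign_sq' [simp]: "koszul_sign i J * (koszul_sign i J * c) = c"
  by (simp flip: mult.assoc)

lemma koszul_sign_nonzero [simp]: "koszul_sign i J \<noteq> 0"
  by (simp add: koszul_sign_def)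

lemma koszul_sign_insert_self [simp]: "koszul_sign i (insert i J) = koszul_sign i J"
  unfolding koszul_sign_def by (rule arg_cong[of _ _ "\<lambda>A. (-1) ^ (card A + 1)"]) auto

lemma koszul_sign_diff_self [simp]: "koszul_sign i (J - {i}) = koszul_sign i J"
  unfolding koszul_sign_def by (rule arg_cong[of _ _ "\<lambda>A. (-1) ^ (card A + 1)"]) auto

lemma koszul_sign_insert:
  assumes "finite J" "j \<notin> J"
  shows "koszul_sign i (insert j J) = (if j < i then - koszul_sign i J else koszul_sign i J)"
proof -
  have "{k \<in> insert j J. k < i} = (if j < i then insert j {k\<in>J. k < i} else {k\<in>J. k < i})" by auto
  then show ?thesis using assms by (simp add: koszul_sign_def)
qed

lemma kd_add: "kd n (\<lambda>m J. f m J + g m J) = (\<lambda>m J. kd n f m J + kd n g m J)"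
  by (simp add: kd_def distrib_left sum.distrib)

lemma kd_diff: "kd n (\<lambda>m J. f m J - g m J) = (\<lambda>m J. kd n f m J - kd n g m J)"
  by (simp add: kd_def right_diff_distrib sum_subtractf)

lemma kd_scale: "kd n (\<lambda>m J. c * f m J) = (\<lambda>m J. c * kd n f m J)"
  by (simp add: kd_def sum_distrib_left mult_ac)

lemma kd_zero [simp]: "kd n (\<lambda>m J. 0) = (\<lambda>m J. 0)"
  by (simp add: kd_def)

lemma sum_antisymmetric_zero:
  fixes h :: "nat \<Rightarrow> nat \<Rightarrow> complex"
  assumes "finite S" "\<And>i j. (i, j) \<in> S \<Longrightarrow> (j, i) \<in> S \<and> h i j = - h j i"
  shows "(\<Sum>(i, j)\<in>S. h i j) = 0"
proof -
  have "(\<Sum>(i, j)\<in>S. h i j) = (\<Sum>(i, j)\<in>S. h j i)"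
    by (rule sum.reindex_bij_witness[of _ prod.swap prod.swap]) (use assms(2) in auto)
  also have "\<dots> = (\<Sum>p\<in>S. - (case p of (i, j) \<Rightarrow> h i j))"
    by (rule sum.cong) (use assms(2) in auto)
  finally show ?thesis by (simp add: sum_negf eq_neg_iff_add_eq_0 flip: mult_2)
qed

text \<open>The two orders in which \<open>i\<close> and \<open>j\<close> are stripped off read the
  same coefficient with opposite signs.\<close>

lemma kd_kd:
  assumes "finite J"
  shows "kd n (kd n f) m J = 0"
proof -
  let ?K = "\<lambda>J m. ({1..n} - J) \<inter> Poly_Mapping.keys m"
  define S where "S = Sigma (?K J m) (\<lambda>i. ?K (insert i J) (m - unit_expo i))"
  define h where "h i j = koszul_sign i J * (koszul_sign j (insert i J) *
    f (m - unit_expo i - unit_expo j) (insert j (insert i J)))" for i j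
  have "kd n (kd n f) m J = (\<Sum>(i, j)\<in>S. h i j)"
    unfolding kd_def S_def h_def by (simp add: sum_distrib_left sum.Sigma)
  also have "\<dots> = 0"
  proof (rule sum_antisymmetric_zero)
    show "finite S" by (simp add: S_def)
    fix i j assume "(i, j) \<in> S"
    then have ij: "i \<in> {1..n}" "i \<notin> J" "i \<in> Poly_Mapping.keys m" "j \<in> {1..n}" "j \<notin> J" "i \<noteq> j"
      "j \<in> Poly_Mapping.keys (m - unit_expo i)" by (auto simp: S_def)
    then have jm: "j \<in> Poly_Mapping.keys m" by (auto simp: keys_diff_unit split: if_splits)
    have "i \<in> Poly_Mapping.keys (m - unit_expo j)" using ij by (auto simp: keys_diff_unit)
    then have "(j, i) \<in> S" using ij jm by (simp add: S_def)
    moreover have "m - unit_expo i - unit_expo j = m - unit_expo j - unit_expo i"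
      by (rule poly_mapping_eqI) (simp add: lookup_minus)
    \<comment> \<open>Inserting the smaller index shifts the position of the larger one, but not
      conversely; this is the one change of sign.\<close>
    moreover have "koszul_sign i J * koszul_sign j (insert i J) =
        - (koszul_sign j J * koszul_sign i (insert j J))"
      using ij assms by (cases "i < j") (auto simp: koszul_sign_insert mult.commute)
    ultimately show "(j, i) \<in> S \<and> h i j = - h j i"
      by (simp add: h_def insert_commute flip: mult.assoc)
  qed
  finally show ?thesis .
qed

section \<open>Supports of cochains and the two gradings\<close>

definition supported :: "(expo \<Rightarrow> nat set \<Rightarrow> bool) \<Rightarrow> cochain \<Rightarrow> bool" where
  "supported P f \<longleftrightarrow> (\<forall>m J. f m J \<noteq> 0 \<longrightarrow> P m J)"

lemma supportedD: "supported P f \<Longrightarrow> f m J \<noteq> 0 \<Longrightarrow> P m J"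
  by (auto simp: supported_def)

lemma supported_kd:
  assumes "supported P f"
    and "\<And>i m J. i \<in> {1..n} - J \<Longrightarrow> i \<in> Poly_Mapping.keys m \<Longrightarrow> P (m - unit_expo i) (insert i J) \<Longrightarrow> Q m J"
  shows "supported Q (kd n f)"
  unfolding supported_def
proof (intro allI impI)
  fix m J assume "kd n f m J \<noteq> 0"
  then obtain i where i: "i \<in> ({1..n} - J) \<inter> Poly_Mapping.keys m"
    "koszul_sign i J * f (m - unit_expo i) (insert i J) \<noteq> 0"
    unfolding kd_def by (meson sum.not_neutral_contains_not_neutral)
  then show "Q m J" using assms(2)[of i J m] supportedD[OF assms(1)] by auto
qed

text \<open>Here \<open>d = s + card J\<close> is the total degree, preserved by the differential, while \<open>s\<close> is
  shifted by one in \<open>pre_chain\<close>, so that \<open>pre_chain n 0 d\<close> only contains zero.\<close>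

definition chain :: "nat \<Rightarrow> nat \<Rightarrow> nat \<Rightarrow> cochain \<Rightarrow> bool" where
  "chain n s d = supported (\<lambda>m J. Poly_Mapping.keys m \<subseteq> {1..n} \<and> J \<subseteq> {1..n} \<and>
     expo_deg m = s \<and> s + card J = d)"

definition pre_chain :: "nat \<Rightarrow> nat \<Rightarrow> nat \<Rightarrow> cochain \<Rightarrow> bool" where
  "pre_chain n s d = supported (\<lambda>m J. Poly_Mapping.keys m \<subseteq> {1..n} \<and> J \<subseteq> {1..n} \<and>
     Suc (expo_deg m) = s \<and> expo_deg m + card J = d)"

lemma pre_chain_Suc: "pre_chain n (Suc s) d = chain n s d"
  unfolding pre_chain_def chain_def by (rule arg_cong[of _ _ supported]) auto

lemma pre_chain_0: "pre_chain n 0 d f \<longleftrightarrow> f = (\<lambda>m J. 0)"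
  by (auto simp: pre_chain_def supported_def fun_eq_iff)

lemma chain_kd:
  assumes "pre_chain n s d f"
  shows "chain n s d (kd n f)"
  unfolding chain_def
proof (rule supported_kd[OF assms[unfolded pre_chain_def]])
  fix i m J
  assume i: "i \<in> {1..n} - J" "i \<in> Poly_Mapping.keys m"
    and *: "Poly_Mapping.keys (m - unit_expo i) \<subseteq> {1..n} \<and> insert i J \<subseteq> {1..n} \<and>
     Suc (expo_deg (m - unit_expo i)) = s \<and> expo_deg (m - unit_expo i) + card (insert i J) = d"
  have "finite J" using * finite_subset[of J "{1..n}"] by simp
  then show "Poly_Mapping.keys m \<subseteq> {1..n} \<and> J \<subseteq> {1..n} \<and> expo_deg m = s \<and> s + card J = d"
    using i * insert_keys_diff_unit[OF i(2)] expo_deg_diff_unit[OF i(2)] by auto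
qed

lemma chain_finite: "chain n s d f \<Longrightarrow> f m J \<noteq> 0 \<Longrightarrow> finite J"
  using finite_subset[of J "{1..n}"] by (auto simp: chain_def supported_def)

lemma kd_kd_chain:
  assumes "pre_chain n s d f"
  shows "kd n (kd n f) = (\<lambda>m J. 0)"
proof (intro ext)
  fix m J
  have "kd n (kd n f) m J \<noteq> 0 \<Longrightarrow> finite J"
    using chain_finite[OF chain_kd[of n "Suc s" d "kd n f"]] chain_kd[OF assms]
    by (simp add: pre_chain_Suc)
  then show "kd n (kd n f) m J = 0" using kd_kd by blast
qed

section \<open>Matching the cells of the basis ideal\<close>

context based_matroid
begin

definition cell :: "expo \<Rightarrow> nat set \<Rightarrow> bool" where
  "cell m J \<longleftrightarrow> Poly_Mapping.keys m \<subseteq> {1..n} \<and> J \<subseteq> {1..n} \<and> spanning (Poly_Mapping.keys m)"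

definition weight :: "expo \<Rightarrow> nat" where
  "weight m = bin_weight (best (Poly_Mapping.keys m))"

text \<open>The support of the cofactor of the squarefree monomial of the best basis dividing \<open>m\<close>.\<close>

definition excess :: "expo \<Rightarrow> nat set" where
  "excess m = {i \<in> Poly_Mapping.keys m. i \<notin> best (Poly_Mapping.keys m) \<or> 2 \<le> Poly_Mapping.lookup m i}"

text \<open>The candidates for toggling: multiplying by a variable outside \<open>passives\<close>
  keeps the best basis, and so does removing one copy of an excess variable. The choice of the pivot
  depends on this set alone, which toggling leaves unchanged.\<close>

definition free_part :: "expo \<Rightarrow> nat set \<Rightarrow> nat set" where
  "free_part m J = (excess m \<union> J) - passives (best (Poly_Mapping.keys m))"

definition pivot :: "expo \<Rightarrow> nat set \<Rightarrow> nat" where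
  "pivot m J = Min (free_part m J)"

text \<open>The differential moves a variable from \<open>J\<close> into the monomial, so upper
  cells are the sources of the matching and \<open>lower\<close> cells its targets.\<close>

definition upper :: "expo \<Rightarrow> nat set \<Rightarrow> bool" where
  "upper m J \<longleftrightarrow> cell m J \<and> free_part m J \<noteq> {} \<and> pivot m J \<in> J"

definition lower :: "expo \<Rightarrow> nat set \<Rightarrow> bool" where
  "lower m J \<longleftrightarrow> cell m J \<and> free_part m J \<noteq> {} \<and> pivot m J \<notin> J"

definition critical :: "expo \<Rightarrow> nat set \<Rightarrow> bool" where
  "critical m J \<longleftrightarrow> cell m J \<and> free_part m J = {}"

lemma cell_cases: "cell m J \<Longrightarrow> upper m J \<or> lower m J \<or> critical m J"
  by (auto simp: upper_def lower_def critical_def)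

lemma pivot_in: "cell m J \<Longrightarrow> free_part m J \<noteq> {} \<Longrightarrow> pivot m J \<in> free_part m J"
  unfolding pivot_def
  using finite_subset[of J "{1..n}"]
  by (intro Min_in) (simp_all add: free_part_def excess_def cell_def)

lemma excess_not_passive:
  assumes "cell m J" "i \<in> excess m"
  shows "i \<notin> passives (best (Poly_Mapping.keys m))"
  by (rule not_passive_best) (use assms in \<open>auto simp: cell_def excess_def\<close>)

lemma best_remove_excess:
  assumes "spanning (Poly_Mapping.keys m)" "i \<in> excess m"
  shows "spanning (Poly_Mapping.keys (m - unit_expo i))"
    "best (Poly_Mapping.keys (m - unit_expo i)) = best (Poly_Mapping.keys m)"
proof -
  have *: "best (Poly_Mapping.keys m) \<subseteq> Poly_Mapping.keys (m - unit_expo i)"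
    using best_props(2)[OF assms(1)] assms(2) by (auto simp: excess_def keys_diff_unit)
  have **: "Poly_Mapping.keys (m - unit_expo i) \<subseteq> Poly_Mapping.keys m"
    by (auto simp: keys_diff_unit)
  show "spanning (Poly_Mapping.keys (m - unit_expo i))"
    by (rule best_subset_eq(1)[OF assms(1) * **])
  show "best (Poly_Mapping.keys (m - unit_expo i)) = best (Poly_Mapping.keys m)"
    by (rule best_subset_eq(2)[OF assms(1) * **])
qed

text \<open>With the best basis unchanged, \<open>i\<close> merely moves between the cofactor and
  \<open>J\<close>, and \<open>free_part\<close> only sees their union.\<close>

lemma free_part_step:
  assumes "i \<in> Poly_Mapping.keys m" "spanning (Poly_Mapping.keys (m - unit_expo i))"
    "best (Poly_Mapping.keys (m - unit_expo i)) = best (Poly_Mapping.keys m)"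
  shows "i \<in> excess m" "free_part (m - unit_expo i) (insert i J) = free_part m J"
proof -
  have sub: "best (Poly_Mapping.keys m) \<subseteq> Poly_Mapping.keys (m - unit_expo i)"
    using best_props(2)[OF assms(2)] assms(3) by simp
  then show i: "i \<in> excess m"
    using assms(1) by (auto simp: excess_def keys_diff_unit split: if_splits)
  have "k \<in> excess m \<longleftrightarrow> k \<in> insert i (excess (m - unit_expo i))" for k
  proof (cases "k = i")
    case True
    then show ?thesis using i by simp
  next
    case False
    then have "k \<in> Poly_Mapping.keys (m - unit_expo i) \<longleftrightarrow> k \<in> Poly_Mapping.keys m"
      "Poly_Mapping.lookup (m - unit_expo i) k = Poly_Mapping.lookup m k"
      by (simp_all add: keys_diff_unit lookup_minus lookup_single when_def)
    with False show ?thesis by (simp add: excess_def assms(3))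
  qed
  then have "excess m = insert i (excess (m - unit_expo i))" by blast
  then show "free_part (m - unit_expo i) (insert i J) = free_part m J"
    by (auto simp: free_part_def assms(3))
qed

lemma cell_remove:
  assumes "cell m J" "i \<in> Poly_Mapping.keys m" "spanning (Poly_Mapping.keys (m - unit_expo i))"
  shows "cell (m - unit_expo i) (insert i J)"
  using assms by (auto simp: cell_def keys_diff_unit)

text \<open>The pivot is in \<open>free_part\<close> but not in \<open>J\<close>, hence it is an
  excess variable; one copy can move into \<open>J\<close> without disturbing the best basis, so the
  partner has the same pivot.\<close>

lemma lower_match:
  assumes low: "lower m J" and i: "i = pivot m J"
  shows "i \<in> Poly_Mapping.keys m" "i \<notin> J" "i \<in> {1..n}" "upper (m - unit_expo i) (insert i J)"
    "pivot (m - unit_expo i) (insert i J) = i" "weight (m - unit_expo i) = weight m"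
proof -
  have c: "cell m J" "free_part m J \<noteq> {}" and iJ: "i \<notin> J" using low i by (auto simp: lower_def)
  have iE: "i \<in> excess m" using pivot_in[OF c] iJ i by (auto simp: free_part_def)
  have b: "spanning (Poly_Mapping.keys (m - unit_expo i))"
    "best (Poly_Mapping.keys (m - unit_expo i)) = best (Poly_Mapping.keys m)"
    using best_remove_excess[OF _ iE] c by (auto simp: cell_def)
  show ik: "i \<in> Poly_Mapping.keys m" using iE by (simp add: excess_def)
  show "i \<notin> J" by (fact iJ)
  show "i \<in> {1..n}" using ik c by (auto simp: cell_def)
  have fp: "free_part (m - unit_expo i) (insert i J) = free_part m J"
    by (rule free_part_step(2)[OF ik b])
  then show piv: "pivot (m - unit_expo i) (insert i J) = i" by (simp add: pivot_def i)
  show "upper (m - unit_expo i) (insert i J)"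
    unfolding upper_def fp piv using cell_remove[OF c(1) ik b(1)] c(2) by simp
  show "weight (m - unit_expo i) = weight m" by (simp add: weight_def b(2))
qed

text \<open>Inverse to the move in \<open>lower_match\<close>. The pivot is not passive, so the
  linear quotient property keeps the best basis when the monomial is multiplied by it.\<close>

lemma upper_match:
  assumes up: "upper m J" and i: "i = pivot m J"
  shows "i \<in> J" "i \<in> {1..n}" "lower (m + unit_expo i) (J - {i})"
    "pivot (m + unit_expo i) (J - {i}) = i" "weight (m + unit_expo i) = weight m"
proof -
  let ?M = "m + unit_expo i"
  have c: "cell m J" "free_part m J \<noteq> {}" and iJ: "i \<in> J" using up i by (auto simp: upper_def)
  then have sp: "spanning (Poly_Mapping.keys m)" and iN: "i \<in> {1..n}" by (auto simp: cell_def)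
  show "i \<in> J" "i \<in> {1..n}" by (fact iJ, fact iN)
  have "i \<notin> passives (best (Poly_Mapping.keys m))"
    using pivot_in[OF c] i by (simp add: free_part_def)
  then have best: "best (Poly_Mapping.keys ?M) = best (Poly_Mapping.keys m)"
    using best_insert_iff[OF sp iN] by simp
  have fp: "free_part ?M (J - {i}) = free_part m J"
    using free_part_step(2)[of i ?M "J - {i}"] sp best iJ by (simp add: insert_absorb)
  show piv: "pivot ?M (J - {i}) = i" unfolding pivot_def fp by (simp add: i pivot_def)
  show "weight ?M = weight m" by (simp only: weight_def best)
  have "cell ?M (J - {i})"
    using c(1) iN spanning_mono[OF sp, of "insert i (Poly_Mapping.keys m)"] by (auto simp: cell_def)
  then show "lower ?M (J - {i})" unfolding lower_def fp piv using c(2) by simp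
qed

text \<open>This makes the differential triangular from upper to lower cells.\<close>

lemma lower_off_pivot:
  assumes low: "lower m J" and j: "j \<in> Poly_Mapping.keys m" "j \<noteq> pivot m J"
    and up: "upper (m - unit_expo j) (insert j J)"
  shows "weight (m - unit_expo j) < weight m"
proof (rule ccontr)
  assume "\<not> ?thesis"
  then have le: "weight m \<le> weight (m - unit_expo j)" by simp
  have sp: "spanning (Poly_Mapping.keys m)" "spanning (Poly_Mapping.keys (m - unit_expo j))"
    using low up by (auto simp: lower_def upper_def cell_def)
  \<comment> \<open>Without a drop in weight both cells have the same best basis, hence the same
    pivot. Being upper puts this pivot in \<open>insert j J\<close>, against
    \<open>lower m J\<close> and the choice of \<open>j\<close>.\<close>
  have "best (Poly_Mapping.keys m) = best (Poly_Mapping.keys (m - unit_expo j))"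
    by (rule best_eqI[OF sp(1)])
      (use best_props[OF sp(2)] le in \<open>auto simp: weight_def keys_diff_unit split: if_splits\<close>)
  then have "free_part (m - unit_expo j) (insert j J) = free_part m J"
    using free_part_step(2)[OF j(1) sp(2)] by simp
  then have "pivot m J \<in> insert j J" using up by (simp add: upper_def pivot_def)
  then show False using low j(2) by (simp add: lower_def)
qed

lemma kd_lower:
  assumes low: "lower m J"
    and off: "\<And>j. j \<in> Poly_Mapping.keys m \<Longrightarrow> j \<noteq> pivot m J \<Longrightarrow> f (m - unit_expo j) (insert j J) = 0"
  shows "kd n f m J = koszul_sign (pivot m J) J * f (m - unit_expo (pivot m J)) (insert (pivot m J) J)"
proof -
  let ?i = "pivot m J"
  let ?S = "({1..n} - J) \<inter> Poly_Mapping.keys m"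
  have "?i \<in> ?S" using lower_match(1,2,3)[OF low refl] by simp
  then show ?thesis
    unfolding kd_def using off
    by (subst sum.remove[of ?S ?i]) (auto intro!: sum.neutral)
qed

text \<open>At the lower partner of an upper cell every other upper contribution has smaller weight
  and vanishes by induction, so the differential there is a sign times the value at the
  cell.\<close>

lemma upper_cycle_zero:
  assumes f: "supported upper f" and zero: "\<And>m J. lower m J \<Longrightarrow> kd n f m J = 0"
  shows "f = (\<lambda>m J. 0)"
proof (intro ext)
  fix m J
  show "f m J = 0"
  proof (induction "weight m" arbitrary: m J rule: less_induct)
    case less
    show ?case
    proof (rule ccontr)
      assume nz: "f m J \<noteq> 0"
      then have up: "upper m J" using supportedD[OF f] by blast
      define i where "i = pivot m J"
      define M where "M = m + unit_expo i"
      note um = upper_match[OF up i_def, folded M_def]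
      have off: "f (M - unit_expo j) (insert j (J - {i})) = 0"
        if j: "j \<in> Poly_Mapping.keys M" "j \<noteq> pivot M (J - {i})" for j
      proof (rule ccontr)
        assume nzj: "f (M - unit_expo j) (insert j (J - {i})) \<noteq> 0"
        have "weight (M - unit_expo j) < weight m"
          using lower_off_pivot[OF um(3) j supportedD[OF f nzj]] um(5) by simp
        then show False using less nzj by blast
      qed
      have "M - unit_expo i = m" "insert i (J - {i}) = J" using um(1) by (auto simp: M_def)
      then have "kd n f M (J - {i}) = koszul_sign i J * f m J"
        using kd_lower[OF um(3), of f] off um(4) by simp
      then show False using zero[OF um(3)] nz by simp
    qed
  qed
qed

section \<open>Cycles in the basis ideal\<close>

definition in_ideal :: "cochain \<Rightarrow> bool" where
  "in_ideal f \<longleftrightarrow> supported (\<lambda>m J. spanning (Poly_Mapping.keys m)) f"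

lemma in_ideal_kd: "in_ideal f \<Longrightarrow> in_ideal (kd n f)"
  unfolding in_ideal_def
  by (erule supported_kd) (auto simp: keys_diff_unit elim: spanning_mono split: if_splits)

text \<open>The best basis lies in \<open>{1..n}\<close>, so its binary digits stop at
  \<open>n\<close>. This bound ends the back substitution in \<open>reduce\<close>.\<close>

lemma weight_bound: "cell m J \<Longrightarrow> weight m < 2 ^ Suc n"
  unfolding weight_def cell_def
  by (intro bin_weight_below) (use best_props basis_subset finite_basis in fastforce)+

text \<open>Back substitution by increasing weight. A correction supported on weight
  \<open>k\<close> reaches a lower cell of weight at most \<open>k\<close> only through its pivot,
  so it leaves the cells already solved untouched.\<close>

lemma reduce_below:
  assumes f: "chain n s d f" "in_ideal f"
  shows "\<exists>g. pre_chain n s d g \<and> supported upper g \<and>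
    (\<forall>m J. lower m J \<longrightarrow> weight m < k \<longrightarrow> f m J = kd n g m J)"
proof (induction k)
  case 0
  show ?case by (rule exI[of _ "\<lambda>m J. 0"]) (simp add: pre_chain_def supported_def)
next
  case (Suc k)
  then obtain g where g: "pre_chain n s d g" "supported upper g"
    "\<And>m J. lower m J \<Longrightarrow> weight m < k \<Longrightarrow> f m J = kd n g m J" by blast
  define h where "h m J = f m J - kd n g m J" for m J
  \<comment> \<open>The triangular system dictates this value: the residual at the lower partner,
    with a sign that squares to 1.\<close>
  define g' where "g' m J = (if upper m J \<and> weight m = k
    then koszul_sign (pivot m J) J * h (m + unit_expo (pivot m J)) (J - {pivot m J}) else 0)" for m J
  have g'_supp: "supported upper g'" by (simp add: supported_def g'_def)
  have h_chain: "chain n s d h"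
    using f(1) chain_kd[OF g(1)] unfolding chain_def supported_def h_def by (metis diff_0_right)
  have g'_pre: "pre_chain n s d g'"
    unfolding pre_chain_def supported_def
  proof (intro allI impI)
    fix m J assume nz: "g' m J \<noteq> 0"
    then have up: "upper m J" by (simp add: g'_def split: if_splits)
    define i where "i = pivot m J"
    note um = upper_match[OF up i_def]
    have nzh: "h (m + unit_expo i) (J - {i}) \<noteq> 0" using nz by (auto simp: g'_def i_def split: if_splits)
    have *: "Poly_Mapping.keys (m + unit_expo i) \<subseteq> {1..n}" "J - {i} \<subseteq> {1..n}"
      "expo_deg (m + unit_expo i) = s" "s + card (J - {i}) = d"
      using supportedD[OF h_chain[unfolded chain_def] nzh] by simp_all
    have "J \<subseteq> {1..n}" using up by (simp add: upper_def cell_def)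
    then have "finite J" using finite_subset by blast
    then have "card J = Suc (card (J - {i}))" using um(1) by (metis card_Suc_Diff1)
    then show "Poly_Mapping.keys m \<subseteq> {1..n} \<and> J \<subseteq> {1..n} \<and>
     Suc (expo_deg m) = s \<and> expo_deg m + card J = d"
      using * \<open>J \<subseteq> {1..n}\<close> by (auto simp: expo_deg_add)
  qed
  have kd_g': "kd n g' m J = (if weight m = k then h m J else 0)"
    if low: "lower m J" "weight m < Suc k" for m J
  proof -
    define i where "i = pivot m J"
    note lm = lower_match[OF low(1) i_def]
    have off: "g' (m - unit_expo j) (insert j J) = 0" if "j \<in> Poly_Mapping.keys m" "j \<noteq> pivot m J" for j
      using lower_off_pivot[OF low(1) that] low(2) by (auto simp: g'_def)
    have "kd n g' m J = koszul_sign i J * g' (m - unit_expo i) (insert i J)"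
      using kd_lower[OF low(1), of g'] off by (simp add: i_def)
    then show ?thesis using lm by (simp add: g'_def)
  qed
  show ?case
  proof (intro exI[of _ "\<lambda>m J. g m J + g' m J"] conjI allI impI)
    show "pre_chain n s d (\<lambda>m J. g m J + g' m J)"
      using g(1) g'_pre unfolding pre_chain_def supported_def by (metis add_0)
    show "supported upper (\<lambda>m J. g m J + g' m J)"
      using g(2) g'_supp unfolding supported_def by (metis add_0)
    fix m J assume "lower m J" "weight m < Suc k"
    then show "f m J = kd n (\<lambda>m J. g m J + g' m J) m J"
      using kd_g' g(3)[of m J] by (auto simp: kd_add h_def less_Suc_eq)
  qed
qed

lemma reduce:
  assumes "chain n s d f" "in_ideal f"
  obtains g where "pre_chain n s d g" "supported upper g" "\<And>m J. lower m J \<Longrightarrow> f m J = kd n g m J"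
proof -
  obtain g where g: "pre_chain n s d g" "supported upper g"
    "\<And>m J. lower m J \<Longrightarrow> weight m < 2 ^ Suc n \<Longrightarrow> f m J = kd n g m J"
    using reduce_below[OF assms, of "2 ^ Suc n"] by blast
  show ?thesis
    by (rule that[OF g(1,2)]) (use g(3) weight_bound in \<open>auto simp: lower_def\<close>)
qed

lemma upper_in_ideal: "supported upper f \<Longrightarrow> in_ideal f"
  by (auto simp: in_ideal_def supported_def upper_def cell_def)

text \<open>The support is confined to upper cells, where triangularity leaves no cycle but
  zero.\<close>

lemma reduced_cycle_zero:
  assumes f: "chain n s d f" "in_ideal f" "kd n f = (\<lambda>m J. 0)"
    and "\<And>m J. lower m J \<Longrightarrow> f m J = 0"
    and "\<And>m J. critical m J \<Longrightarrow> expo_deg m = s \<Longrightarrow> s + card J = d \<Longrightarrow> f m J = 0"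
  shows "f = (\<lambda>m J. 0)"
proof (rule upper_cycle_zero)
  show "supported upper f"
    unfolding supported_def
  proof (intro allI impI)
    fix m J assume nz: "f m J \<noteq> 0"
    then have "cell m J" "expo_deg m = s" "s + card J = d"
      using f(1,2) by (auto simp: chain_def in_ideal_def supported_def cell_def)
    then show "upper m J" using cell_cases assms(4,5) nz by blast
  qed
qed (simp add: f(3))

text \<open>Subtracting the boundary from \<open>reduce\<close> clears the lower cells; with no
  critical cell in this bidegree nothing remains of the cycle.\<close>

lemma ideal_exact:
  assumes f: "chain n s d f" "in_ideal f" "kd n f = (\<lambda>m J. 0)"
    and ncrit: "\<And>m J. critical m J \<Longrightarrow> expo_deg m = s \<Longrightarrow> s + card J = d \<Longrightarrow> False"
  obtains g where "pre_chain n s d g" "in_ideal g" "f = kd n g"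
proof -
  obtain g where g: "pre_chain n s d g" "supported upper g" "\<And>m J. lower m J \<Longrightarrow> f m J = kd n g m J"
    by (rule reduce[OF f(1,2)]) blast
  have gI: "in_ideal g" by (rule upper_in_ideal[OF g(2)])
  have "(\<lambda>m J. f m J - kd n g m J) = (\<lambda>m J. 0)"
  proof (rule reduced_cycle_zero)
    show "chain n s d (\<lambda>m J. f m J - kd n g m J)"
      using f(1) chain_kd[OF g(1)] unfolding chain_def supported_def by (metis diff_0_right)
    show "in_ideal (\<lambda>m J. f m J - kd n g m J)"
      using f(2) in_ideal_kd[OF gI] unfolding in_ideal_def supported_def by (metis diff_0_right)
    show "kd n (\<lambda>m J. f m J - kd n g m J) = (\<lambda>m J. 0)"
      by (simp add: kd_diff f(3) kd_kd_chain[OF g(1)])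
  qed (use g(3) ncrit in auto)
  then show ?thesis using that[OF g(1) gI] by (simp add: fun_eq_iff)
qed

text \<open>Excess variables are never passive, so an empty \<open>free_part\<close> leaves no
  cofactor: \<open>m\<close> is the squarefree monomial of its best basis.\<close>

lemma critical_expo_deg:
  assumes "critical m J"
  shows "expo_deg m = matroid_rank \<B>" "Poly_Mapping.keys m = best (Poly_Mapping.keys m)"
    "\<And>i. i \<in> Poly_Mapping.keys m \<Longrightarrow> Poly_Mapping.lookup m i = 1"
    "J \<subseteq> passives (best (Poly_Mapping.keys m))"
proof -
  have c: "cell m J" and e: "free_part m J = {}" using assms by (auto simp: critical_def)
  have sp: "spanning (Poly_Mapping.keys m)" using c by (simp add: cell_def)
  have ex: "excess m = {}" using excess_not_passive[OF c] e by (auto simp: free_part_def)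
  show keys: "Poly_Mapping.keys m = best (Poly_Mapping.keys m)"
    using ex best_props(2)[OF sp] by (auto simp: excess_def)
  show one: "Poly_Mapping.lookup m i = 1" if "i \<in> Poly_Mapping.keys m" for i
    using that ex by (auto simp: excess_def in_keys_iff) (metis Suc_leI gr0I le_antisym not_less_eq_eq numeral_2_eq_2)
  show "J \<subseteq> passives (best (Poly_Mapping.keys m))" using e by (auto simp: free_part_def)
  have "expo_deg m = card (Poly_Mapping.keys m)" by (simp add: expo_deg_def one)
  also have "\<dots> = matroid_rank \<B>" using keys card_basis[OF best_props(1)[OF sp]] by simp
  finally show "expo_deg m = matroid_rank \<B>" .
qed

lemma rank_le_expo_deg:
  assumes sp: "spanning (Poly_Mapping.keys m)"
  shows "matroid_rank \<B> \<le> expo_deg m"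
proof -
  have "matroid_rank \<B> = card (best (Poly_Mapping.keys m))"
    using card_basis[OF best_props(1)[OF sp]] by simp
  also have "\<dots> \<le> card (Poly_Mapping.keys m)" by (rule card_mono) (simp_all add: best_props(2)[OF sp])
  also have "\<dots> \<le> expo_deg m"
    unfolding expo_deg_def card_eq_sum by (rule sum_mono) (simp add: in_keys_iff Suc_le_eq)
  finally show ?thesis .
qed

text \<open>The upper partner still has a spanning support in degree one less, and no monomial of
  degree below the rank has one.\<close>

lemma not_lower_rank:
  assumes "lower m J" shows "expo_deg m \<noteq> matroid_rank \<B>"
proof -
  define i where "i = pivot m J"
  note lm = lower_match[OF assms i_def]
  have "matroid_rank \<B> \<le> expo_deg (m - unit_expo i)"
    by (rule rank_le_expo_deg) (use lm(4) in \<open>simp add: upper_def cell_def\<close>)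
  then show ?thesis using expo_deg_diff_unit[OF lm(1)] by simp
qed

text \<open>In polynomial degree \<open>r\<close> there are no lower cells, so the critical values
  determine a cycle. \<open>rank_cycle_extension\<close> shows that these values are
  arbitrary.\<close>

lemma rank_cycle_zero:
  assumes f: "chain n (matroid_rank \<B>) d f" "in_ideal f" "kd n f = (\<lambda>m J. 0)"
    and "\<And>m J. critical m J \<Longrightarrow> f m J = 0"
  shows "f = (\<lambda>m J. 0)"
proof (rule reduced_cycle_zero[OF f])
  fix m J assume "lower m J"
  then have "expo_deg m \<noteq> matroid_rank \<B>" by (rule not_lower_rank)
  then show "f m J = 0" using f(1) by (auto simp: chain_def supported_def)
qed (rule assms(4))

text \<open>An upper cochain is subtracted from \<open>c\<close> to cancel its differential; upper
  cells are not critical, so the prescribed values survive.\<close>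

lemma rank_cycle_extension:
  assumes c: "chain n (matroid_rank \<B>) d c" "supported critical c"
  obtains w where "chain n (matroid_rank \<B>) d w" "in_ideal w" "kd n w = (\<lambda>m J. 0)"
    "\<And>m J. critical m J \<Longrightarrow> w m J = c m J"
proof -
  let ?r = "matroid_rank \<B>"
  have cI: "in_ideal c" using c(2) by (auto simp: in_ideal_def supported_def critical_def cell_def)
  have ch: "chain n (Suc ?r) d (kd n c)" using chain_kd[of n "Suc ?r"] c(1) by (simp add: pre_chain_Suc)
  obtain g where g: "chain n ?r d g" "supported upper g"
      "\<And>m J. lower m J \<Longrightarrow> kd n c m J = kd n g m J"
    by (rule reduce[OF ch in_ideal_kd[OF cI]]) (simp add: pre_chain_Suc)
  have gI: "in_ideal g" by (rule upper_in_ideal[OF g(2)])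
  have dg: "chain n (Suc ?r) d (kd n g)" using chain_kd[of n "Suc ?r"] g(1) by (simp add: pre_chain_Suc)
  define w where "w m J = c m J - g m J" for m J
  have kw: "kd n w = (\<lambda>m J. kd n c m J - kd n g m J)" unfolding w_def by (rule kd_diff)
  have w: "chain n ?r d w"
    using c(1) g(1) unfolding chain_def supported_def w_def by (metis diff_0_right)
  have wI: "in_ideal w"
    using cI gI unfolding in_ideal_def supported_def w_def by (metis diff_0_right)
  \<comment> \<open>This cycle lives in degree \<open>r + 1\<close>, where no cell is critical, and
    \<open>g\<close> was chosen to cancel it on the lower cells.\<close>
  have "kd n w = (\<lambda>m J. 0)"
  proof (rule reduced_cycle_zero)
    show "chain n (Suc ?r) d (kd n w)" using chain_kd[of n "Suc ?r"] w by (simp add: pre_chain_Suc)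
    show "in_ideal (kd n w)" by (rule in_ideal_kd[OF wI])
    show "kd n (kd n w) = (\<lambda>m J. 0)" using kd_kd_chain[of n "Suc ?r"] w by (simp add: pre_chain_Suc)
  qed (use g(3) critical_expo_deg(1) in \<open>auto simp: kw\<close>)
  moreover have "w m J = c m J" if "critical m J" for m J
  proof -
    have "\<not> upper m J" using that by (auto simp: upper_def critical_def)
    then have "g m J = 0" using g(2) by (auto simp: supported_def)
    then show ?thesis by (simp add: w_def)
  qed
  ultimately show ?thesis using that w wI by blast
qed

end

section \<open>Homology of the quotient complex\<close>

text \<open>The polynomial ring itself is the basis ideal of the matroid whose only basis is empty.\<close>

lemma poly_exact:
  assumes f: "chain n s d f" "kd n f = (\<lambda>m J. 0)" and "d > 0"
  obtains g where "pre_chain n s d g" "f = kd n g"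
proof -
  interpret triv: based_matroid n "{{}}"
    by unfold_locales (simp add: matroid_on_def)
  have sp: "triv.spanning T" for T by (simp add: triv.spanning_def)
  have best: "triv.best T = {}" for T using triv.best_props(1)[OF sp] by simp
  have "triv.passives {} = {}" by (simp add: triv.passives_def)
  \<comment> \<open>The only critical cell is the unit monomial with \<open>J = {}\<close>, of total
    degree 0; this is where positivity of \<open>d\<close> enters.\<close>
  then have "False" if "triv.critical m J" "expo_deg m = s" "s + card J = d" for m J
    using triv.critical_expo_deg(2,4)[OF that(1)] that(2,3) \<open>d > 0\<close>
    by (simp add: best expo_deg_def)
  moreover have "triv.in_ideal f" by (simp add: triv.in_ideal_def supported_def sp)
  ultimately show ?thesis using triv.ideal_exact[OF f(1) _ f(2)] that by metis
qed

context based_matroid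
begin

text \<open>Modulo a monomial ideal each class has one representative without monomials of the
  ideal. The quotient complex is modelled on these normal forms, with the truncated differential
  \<open>qd\<close>.\<close>

definition off_ideal :: "cochain \<Rightarrow> bool" where
  "off_ideal f \<longleftrightarrow> supported (\<lambda>m J. \<not> spanning (Poly_Mapping.keys m)) f"

definition qd :: "cochain \<Rightarrow> cochain" where
  "qd f = (\<lambda>m J. if spanning (Poly_Mapping.keys m) then 0 else kd n f m J)"

lemma qd_zero_imp_in_ideal: "qd f = (\<lambda>m J. 0) \<Longrightarrow> in_ideal (kd n f)"
  unfolding qd_def in_ideal_def supported_def by (metis (full_types))

text \<open>Modulo the ideal \<open>g\<close> disappears. The ideal terms of \<open>h\<close> may be
  dropped as well, because the differential at a monomial off the ideal only reads its divisors,
  which are off the ideal too.\<close>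

lemma quotient_boundary:
  assumes f: "off_ideal f" and g: "in_ideal g"
    and h: "pre_chain n s d h" "(\<lambda>m J. f m J - g m J) = kd n h"
  shows "\<exists>h. pre_chain n s d h \<and> off_ideal h \<and> f = qd h"
proof -
  define h' where "h' m J = (if spanning (Poly_Mapping.keys m) then 0 else h m J)" for m J
  have "f m J = qd h' m J" for m J
  proof (cases "spanning (Poly_Mapping.keys m)")
    case True
    then show ?thesis using f by (auto simp: qd_def off_ideal_def supported_def)
  next
    case False
    have "f m J - g m J = kd n h m J" using h(2) by metis
    also have "g m J = 0" using g False by (auto simp: in_ideal_def supported_def)
    also have "kd n h m J = kd n h' m J"
      unfolding kd_def
    proof (intro sum.cong refl)
      fix i
      have "Poly_Mapping.keys (m - unit_expo i) \<subseteq> Poly_Mapping.keys m" by (simp add: keys_diff_unit)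
      then have "\<not> spanning (Poly_Mapping.keys (m - unit_expo i))" using False spanning_mono by metis
      then show "koszul_sign i J * h (m - unit_expo i) (insert i J) =
        koszul_sign i J * h' (m - unit_expo i) (insert i J)" by (simp add: h'_def)
    qed
    finally show ?thesis using False by (simp add: qd_def)
  qed
  moreover have "pre_chain n s d h'" "off_ideal h'"
    using h(1) by (auto simp: pre_chain_def off_ideal_def supported_def h'_def)
  ultimately show ?thesis by (intro exI[of _ h']) auto
qed

lemma chain_Suc_kd: "chain n s d f \<Longrightarrow> chain n (Suc s) d (kd n f)"
  using chain_kd[of n "Suc s"] by (simp add: pre_chain_Suc)

text \<open>The diagram chase of the long exact sequence: \<open>kd n f\<close> is a cycle of the
  ideal away from degree \<open>r\<close>, so it bounds some \<open>g\<close> there, and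
  \<open>f - g\<close> bounds in the polynomial ring.\<close>

lemma quotient_exact:
  assumes f: "chain n s d f" "off_ideal f" "qd f = (\<lambda>m J. 0)"
    and "d > 0" "Suc s \<noteq> matroid_rank \<B>"
  shows "\<exists>h. pre_chain n s d h \<and> off_ideal h \<and> f = qd h"
proof -
  have ff: "kd n (kd n f) = (\<lambda>m J. 0)" using kd_kd_chain[of n "Suc s"] f(1) by (simp add: pre_chain_Suc)
  obtain g where g: "chain n s d g" "in_ideal g" "kd n f = kd n g"
    by (rule ideal_exact[OF chain_Suc_kd[OF f(1)] qd_zero_imp_in_ideal[OF f(3)] ff])
      (use critical_expo_deg(1) assms(5) in \<open>auto simp: pre_chain_Suc\<close>)
  have c: "chain n s d (\<lambda>m J. f m J - g m J)"
    using f(1) g(1) unfolding chain_def supported_def by (metis diff_0_right)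
  obtain h where "pre_chain n s d h" "(\<lambda>m J. f m J - g m J) = kd n h"
    by (rule poly_exact[OF c _ \<open>d > 0\<close>]) (simp_all add: kd_diff g(3))
  then show ?thesis by (rule quotient_boundary[OF f(2) g(2)])
qed

text \<open>Injectivity of the connecting map. A degree-\<open>r\<close> cycle of the ideal with
  zero critical values is zero, so \<open>f\<close> is already a cycle, hence a boundary, over the
  polynomial ring.\<close>

lemma quotient_rank_kernel:
  assumes f: "chain n s d f" "off_ideal f" "qd f = (\<lambda>m J. 0)"
    and "d > 0" "Suc s = matroid_rank \<B>"
    and zero: "\<And>m J. critical m J \<Longrightarrow> kd n f m J = 0"
  shows "\<exists>h. pre_chain n s d h \<and> off_ideal h \<and> f = qd h"
proof -
  have "kd n (kd n f) = (\<lambda>m J. 0)" using kd_kd_chain[of n "Suc s"] f(1) by (simp add: pre_chain_Suc)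
  then have kf: "kd n f = (\<lambda>m J. 0)"
    using rank_cycle_zero[of d "kd n f"] chain_Suc_kd[OF f(1)] qd_zero_imp_in_ideal[OF f(3)] zero assms(5)
    by simp
  obtain h where h: "pre_chain n s d h" "f = kd n h"
    by (rule poly_exact[OF f(1) kf \<open>d > 0\<close>])
  show ?thesis
    by (rule quotient_boundary[OF f(2), of "\<lambda>m J. 0" s d h])
      (use h in \<open>simp_all add: in_ideal_def supported_def\<close>)
qed

text \<open>Surjectivity of the connecting map: a cycle of the ideal with the prescribed critical
  values bounds some \<open>f\<close> in the polynomial ring. Its degree \<open>r - 1\<close> is too
  small for \<open>f\<close> to meet the ideal.\<close>

lemma quotient_rank_surj:
  assumes c: "chain n (matroid_rank \<B>) d c" "supported critical c"
    and "d > 0" "Suc s = matroid_rank \<B>"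
  obtains f where "chain n s d f" "off_ideal f" "qd f = (\<lambda>m J. 0)"
    "\<And>m J. critical m J \<Longrightarrow> kd n f m J = c m J"
proof -
  obtain w where w: "chain n (matroid_rank \<B>) d w" "in_ideal w" "kd n w = (\<lambda>m J. 0)"
    "\<And>m J. critical m J \<Longrightarrow> w m J = c m J"
    by (rule rank_cycle_extension[OF c]) blast
  obtain f where f: "chain n s d f" "w = kd n f"
    by (rule poly_exact[OF w(1,3) \<open>d > 0\<close>]) (simp add: pre_chain_Suc flip: assms(4))
  show ?thesis
  proof (rule that[OF f(1)])
    show "off_ideal f"
      using f(1) rank_le_expo_deg assms(4)
      unfolding off_ideal_def chain_def supported_def by (metis not_less_eq_eq order_refl)
    show "qd f = (\<lambda>m J. 0)"
      using w(2) f(2) unfolding qd_def in_ideal_def supported_def by (metis (full_types))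
  qed (use w(4) f(2) in simp)
qed

text \<open>\<open>t\<close> is the exterior degree in the quotient complex; the connecting map
  lowers it by one, whence the \<open>Suc\<close>.\<close>

definition crit_cells :: "nat \<Rightarrow> (expo \<times> nat set) set" where
  "crit_cells t = {(m, J). critical m J \<and> Suc (card J) = t}"

definition indicator_expo :: "nat set \<Rightarrow> expo" where
  "indicator_expo B = (\<Sum>i\<in>B. unit_expo i)"

lemma lookup_indicator_expo:
  "finite B \<Longrightarrow> Poly_Mapping.lookup (indicator_expo B) i = (if i \<in> B then 1 else 0)"
  by (simp add: indicator_expo_def lookup_sum lookup_single when_def)

lemma keys_indicator_expo: "finite B \<Longrightarrow> Poly_Mapping.keys (indicator_expo B) = B"
  by (auto simp: in_keys_iff lookup_indicator_expo split: if_splits)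

lemma critical_indicator_expo:
  assumes "B \<in> \<B>" "J \<subseteq> passives B"
  shows "critical (indicator_expo B) J"
proof -
  have k: "Poly_Mapping.keys (indicator_expo B) = B"
    by (rule keys_indicator_expo[OF finite_basis[OF assms(1)]])
  have sp: "spanning B" using assms(1) by (auto simp: spanning_def)
  have "best B = B"
    using basis_subset_eq[OF best_props(1)[OF sp] assms(1) best_props(2)[OF sp]] .
  then show ?thesis
    using assms basis_subset[OF assms(1)] passives_subset[of B] sp finite_basis[OF assms(1)]
    by (auto simp: critical_def cell_def free_part_def excess_def k lookup_indicator_expo)
qed

text \<open>A critical monomial is squarefree with a basis as support, so its support recovers it,
  while \<open>J\<close> ranges freely over sets of passive elements.\<close>

lemma crit_cells_bij:
  "bij_betw (\<lambda>(B, J). (indicator_expo B, J))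
     (SIGMA B:\<B>. {J. J \<subseteq> passives B \<and> Suc (card J) = t}) (crit_cells t)"
proof (rule bij_betw_byWitness[where f' = "\<lambda>(m, J). (Poly_Mapping.keys m, J)"])
  show "\<forall>a\<in>SIGMA B:\<B>. {J. J \<subseteq> passives B \<and> Suc (card J) = t}.
      (case case a of (B, J) \<Rightarrow> (indicator_expo B, J) of (m, J) \<Rightarrow> (Poly_Mapping.keys m, J)) = a"
    by (auto simp: keys_indicator_expo finite_basis)
  show "\<forall>a'\<in>crit_cells t.
      (case case a' of (m, J) \<Rightarrow> (Poly_Mapping.keys m, J) of (B, J) \<Rightarrow> (indicator_expo B, J)) = a'"
    using critical_expo_deg(3)
    by (auto simp: crit_cells_def lookup_indicator_expo in_keys_iff intro!: poly_mapping_eqI)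
  show "(\<lambda>(B, J). (indicator_expo B, J)) ` (SIGMA B:\<B>. {J. J \<subseteq> passives B \<and> Suc (card J) = t})
      \<subseteq> crit_cells t"
    by (auto simp: crit_cells_def critical_indicator_expo)
  show "(\<lambda>(m, J). (Poly_Mapping.keys m, J)) ` crit_cells t
      \<subseteq> (SIGMA B:\<B>. {J. J \<subseteq> passives B \<and> Suc (card J) = t})"
  proof (rule image_subsetI)
    fix p assume "p \<in> crit_cells t"
    then obtain m J where p: "p = (m, J)" and c: "critical m J" and t: "Suc (card J) = t"
      by (auto simp: crit_cells_def)
    have "best (Poly_Mapping.keys m) \<in> \<B>"
      using c best_props(1) by (simp add: critical_def cell_def)
    then show "(case p of (m, J) \<Rightarrow> (Poly_Mapping.keys m, J)) \<in>
        (SIGMA B:\<B>. {J. J \<subseteq> passives B \<and> Suc (card J) = t})"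
      using critical_expo_deg(2,4)[OF c] t by (simp add: p)
  qed
qed

lemma finite_crit_cells: "finite (crit_cells t)"
  using crit_cells_bij[of t] finite_bases finite_passives
  by (auto simp: bij_betw_finite[symmetric] intro!: finite_SigmaI)

lemma card_crit_cells:
  "card (crit_cells t) = (if t = 0 then 0 else \<Sum>B\<in>\<B>. card (passives B) choose (t - 1))"
proof (cases t)
  case (Suc k)
  have "card (crit_cells t) = card (SIGMA B:\<B>. {J. J \<subseteq> passives B \<and> Suc (card J) = t})"
    using bij_betw_same_card[OF crit_cells_bij] by simp
  also have "\<dots> = (\<Sum>B\<in>\<B>. card (passives B) choose k)"
    using finite_bases finite_passives by (simp add: Suc n_subsets)
  finally show ?thesis by (simp add: Suc)
qed (simp add: crit_cells_def)

end

section \<open>Dimension of a quotient module\<close>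

text \<open>The vector space axioms of \<open>V\<close> are themselves pulled across
  \<open>S\<close> from the standard space, as \<open>quot_module\<close> is only a record.\<close>

lemma vectorspace_transport:
  fixes V :: "(complex, 'v) module" and S :: "complex vec \<Rightarrow> 'v"
  assumes carrier: "carrier V = S ` carrier_vec k"
    and zero: "\<zero>\<^bsub>V\<^esub> = S (0\<^sub>v k)"
    and add: "\<And>v w. v \<in> carrier_vec k \<Longrightarrow> w \<in> carrier_vec k \<Longrightarrow> S v \<oplus>\<^bsub>V\<^esub> S w = S (v + w)"
    and smult: "\<And>c v. v \<in> carrier_vec k \<Longrightarrow> c \<odot>\<^bsub>V\<^esub> S v = S (c \<cdot>\<^sub>v v)"
    and inj: "inj_on S (carrier_vec k)"
  shows "vectorspace.dim class_ring V = k"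
proof -
  interpret vec: vec_space "TYPE(complex)" k .
  have grp: "abelian_group V"
  proof (rule abelian_groupI)
    fix x assume "x \<in> carrier V"
    then obtain v where v: "v \<in> carrier_vec k" "x = S v" using carrier by auto
    then have "S (- v) \<oplus>\<^bsub>V\<^esub> x = \<zero>\<^bsub>V\<^esub>" by (simp add: add zero)
    then show "\<exists>y\<in>carrier V. y \<oplus>\<^bsub>V\<^esub> x = \<zero>\<^bsub>V\<^esub>" using v carrier by (auto intro!: bexI[of _ "S (- v)"])
    show "\<zero>\<^bsub>V\<^esub> \<oplus>\<^bsub>V\<^esub> x = x" using v by (simp add: add zero)
  qed (auto simp: carrier zero add comm_add_vec intro: arg_cong[of _ _ S])
  have "module class_ring V"
    by (rule moduleI[OF class_cring.cring_axioms grp])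
      (auto simp: carrier smult add smult_add_distrib_vec add_smult_distrib_vec smult_smult_assoc)
  then have vs: "vectorspace class_ring V"
    unfolding vectorspace_def using class_field by auto
  have hom: "S \<in> module_hom class_ring (module_vec TYPE(complex) k) V"
    by (auto simp: module_hom_def module_vec_simps carrier add smult)
  interpret linear_map class_ring "module_vec TYPE(complex) k" V S
    unfolding linear_map_def mod_hom_def mod_hom_axioms_def
    using vs vec_vs[where 'a = complex and n = k] hom by (auto simp: vectorspace_def)
  have "vec.dim = vectorspace.dim class_ring V"
    by (rule dim_eq) (use inj carrier in \<open>auto simp: module_vec_simps\<close>)
  then show ?thesis by (simp add: vec.dim_is_n)
qed

text \<open>The first isomorphism theorem: \<open>\<phi>\<close> restricted to \<open>C\<close> maps
  \<open>M\<close> onto the functions on \<open>C\<close> with kernel \<open>N\<close>, so the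
  cosets are its fibres. The injective coordinates \<open>\<iota>\<close> stand in for the group
  laws of \<open>M\<close>.\<close>

lemma dim_quot_module:
  fixes M :: "(complex, 'v) module" and \<iota> :: "'v \<Rightarrow> 'x \<Rightarrow> complex" and \<phi> :: "'v \<Rightarrow> 'c \<Rightarrow> complex"
  assumes add: "\<And>f g. f \<in> carrier M \<Longrightarrow> g \<in> carrier M \<Longrightarrow> f \<oplus>\<^bsub>M\<^esub> g \<in> carrier M"
    and smult: "\<And>c f. f \<in> carrier M \<Longrightarrow> c \<odot>\<^bsub>M\<^esub> f \<in> carrier M"
    and inj: "inj_on \<iota> (carrier M)"
    and \<iota>_add: "\<And>f g x. f \<in> carrier M \<Longrightarrow> g \<in> carrier M \<Longrightarrow> \<iota> (f \<oplus>\<^bsub>M\<^esub> g) x = \<iota> f x + \<iota> g x"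
    and \<iota>_smult: "\<And>c f x. f \<in> carrier M \<Longrightarrow> \<iota> (c \<odot>\<^bsub>M\<^esub> f) x = c * \<iota> f x"
    and \<phi>_add: "\<And>f g x. f \<in> carrier M \<Longrightarrow> g \<in> carrier M \<Longrightarrow> \<phi> (f \<oplus>\<^bsub>M\<^esub> g) x = \<phi> f x + \<phi> g x"
    and \<phi>_smult: "\<And>c f x. f \<in> carrier M \<Longrightarrow> \<phi> (c \<odot>\<^bsub>M\<^esub> f) x = c * \<phi> f x"
    and C: "finite C"
    and N: "N = {f \<in> carrier M. \<forall>x\<in>C. \<phi> f x = 0}"
    and surj: "\<And>v. \<exists>f\<in>carrier M. \<forall>x\<in>C. \<phi> f x = v x"
  shows "vectorspace.dim class_ring (quot_module M N) = card C"
proof -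
  define k where "k = card C"
  obtain e where e: "bij_betw e {0..<k} C"
    using ex_bij_betw_nat_finite[OF C] by (auto simp: k_def)
  have eC: "i < k \<Longrightarrow> e i \<in> C" for i using e by (auto simp: bij_betw_def)
  define S where "S v = {f \<in> carrier M. \<forall>i<k. \<phi> f (e i) = v $ i}" for v :: "complex vec"
  let ?Q = "quot_module M N"
  have S_ne: "\<exists>f. f \<in> S v" for v
  proof -
    obtain f where f: "f \<in> carrier M" "\<forall>x\<in>C. \<phi> f x = v $ the_inv_into {0..<k} e x"
      using surj[of "\<lambda>x. v $ the_inv_into {0..<k} e x"] by blast
    have "\<phi> f (e i) = v $ i" if "i < k" for i
      using f(2) eC[OF that] the_inv_into_f_f[of e "{0..<k}" i] e that by (simp add: bij_betw_def)
    then show ?thesis using f(1) by (auto simp: S_def)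
  qed
  have N_S: "N = S (0\<^sub>v k)"
  proof -
    have "(\<forall>x\<in>C. \<phi> f x = 0) \<longleftrightarrow> (\<forall>i<k. \<phi> f (e i) = 0)" for f
      using e by (metis atLeastLessThan_iff bij_betw_iff_bijections zero_le)
    then show ?thesis by (auto simp: N S_def)
  qed
  have set_add: "set_add M (S v) (S w) = S (v + w)"
    if v: "v \<in> carrier_vec k" and w: "w \<in> carrier_vec k" for v w
  proof
    show "set_add M (S v) (S w) \<subseteq> S (v + w)"
      using v w by (auto simp: set_add_def' S_def add \<phi>_add)
    show "S (v + w) \<subseteq> set_add M (S v) (S w)"
    proof
      fix h assume h: "h \<in> S (v + w)"
      obtain f where f: "f \<in> S v" using S_ne by blast
      have hM: "h \<in> carrier M" and fM: "f \<in> carrier M" using h f by (auto simp: S_def)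
      define g where "g = h \<oplus>\<^bsub>M\<^esub> (- 1) \<odot>\<^bsub>M\<^esub> f"
      have gM: "g \<in> carrier M" using hM fM by (simp add: g_def add smult)
      have "\<phi> g x = \<phi> h x - \<phi> f x" for x
        using hM fM by (simp add: g_def \<phi>_add \<phi>_smult smult)
      then have "g \<in> S w" using gM h f v w by (auto simp: S_def)
      \<comment> \<open>Cancellation is checked in the coordinates \<open>\<iota>\<close>, where it
        is arithmetic of complex numbers.\<close>
      moreover have "f \<oplus>\<^bsub>M\<^esub> g = h"
        by (rule inj_onD[OF inj])
          (use hM fM gM in \<open>auto simp: g_def fun_eq_iff \<iota>_add \<iota>_smult add smult\<close>)
      ultimately show "h \<in> set_add M (S v) (S w)" using f by (auto simp: set_add_def')
    qed
  qed
  have coset: "N +>\<^bsub>M\<^esub> f = S v" if f: "f \<in> S v" and v: "v \<in> carrier_vec k" for f v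
  proof
    show "N +>\<^bsub>M\<^esub> f \<subseteq> S v"
      using f v by (auto simp: a_r_coset_def' N_S S_def add \<phi>_add)
    show "S v \<subseteq> N +>\<^bsub>M\<^esub> f"
    proof
      fix h assume h: "h \<in> S v"
      have hM: "h \<in> carrier M" and fM: "f \<in> carrier M" using h f by (auto simp: S_def)
      define g where "g = h \<oplus>\<^bsub>M\<^esub> (- 1) \<odot>\<^bsub>M\<^esub> f"
      have gM: "g \<in> carrier M" using hM fM by (simp add: g_def add smult)
      have "\<phi> g x = \<phi> h x - \<phi> f x" for x
        using hM fM by (simp add: g_def \<phi>_add \<phi>_smult smult)
      then have "g \<in> N" using gM h f by (auto simp: S_def N_S)
      moreover have "g \<oplus>\<^bsub>M\<^esub> f = h"
        by (rule inj_onD[OF inj])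
          (use hM fM gM in \<open>auto simp: g_def fun_eq_iff \<iota>_add \<iota>_smult add smult\<close>)
      ultimately show "h \<in> N +>\<^bsub>M\<^esub> f" by (auto simp: a_r_coset_def')
    qed
  qed
  have "vectorspace.dim class_ring ?Q = k"
  proof (rule vectorspace_transport[where S = S])
    show "carrier ?Q = S ` carrier_vec k"
    proof (intro equalityI subsetI)
      fix A assume "A \<in> carrier ?Q"
      then obtain f where f: "f \<in> carrier M" "A = N +>\<^bsub>M\<^esub> f"
        by (auto simp: quot_module_def A_RCOSETS_def')
      have "f \<in> S (vec k (\<lambda>i. \<phi> f (e i)))" using f(1) by (simp add: S_def)
      then have "A = S (vec k (\<lambda>i. \<phi> f (e i)))" using coset f(2) by simp
      then show "A \<in> S ` carrier_vec k" by simp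
    next
      fix A assume "A \<in> S ` carrier_vec k"
      then obtain v where v: "v \<in> carrier_vec k" "A = S v" by auto
      obtain f where f: "f \<in> S v" using S_ne by blast
      then show "A \<in> carrier ?Q"
        using coset[OF f v(1)] v(2) by (auto simp: quot_module_def A_RCOSETS_def' S_def)
    qed
    show "\<zero>\<^bsub>?Q\<^esub> = S (0\<^sub>v k)" by (simp add: quot_module_def N_S)
    show "S v \<oplus>\<^bsub>?Q\<^esub> S w = S (v + w)" if "v \<in> carrier_vec k" "w \<in> carrier_vec k" for v w
      using set_add[OF that] by (simp add: quot_module_def)
    show "c \<odot>\<^bsub>?Q\<^esub> S v = S (c \<cdot>\<^sub>v v)" if v: "v \<in> carrier_vec k" for c v
    proof -
      \<comment> \<open>Scalar multiplication of a coset is a union over its representatives; all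
        members of that union coincide.\<close>
      have "N +>\<^bsub>M\<^esub> (c \<odot>\<^bsub>M\<^esub> f) = S (c \<cdot>\<^sub>v v)" if "f \<in> S v" for f
        by (rule coset) (use that v in \<open>auto simp: S_def smult \<phi>_smult\<close>)
      then have "c \<odot>\<^bsub>?Q\<^esub> S v = (\<Union>f\<in>S v. S (c \<cdot>\<^sub>v v))" by (simp add: quot_module_def)
      then show ?thesis using S_ne[of v] by auto
    qed
    show "inj_on S (carrier_vec k)"
    proof (rule inj_onI)
      fix v w assume vw: "v \<in> carrier_vec k" "w \<in> carrier_vec k" "S v = S w"
      obtain f where f: "f \<in> S v" using S_ne by blast
      then have "f \<in> S w" using vw(3) by simp
      have "v $ i = w $ i" if "i < k" for i
      proof -
        have "\<phi> f (e i) = v $ i" "\<phi> f (e i) = w $ i"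
          using f \<open>f \<in> S w\<close> that by (simp_all add: S_def)
        then show ?thesis by simp
      qed
      then show "v = w" using vw(1,2) by (intro eq_vecI) auto
    qed
  qed
  then show ?thesis by (simp add: k_def)
qed

section \<open>The polynomial ring and the basis ideal\<close>

lemma lookup_single_times:
  fixes p :: cpoly
  shows "Poly_Mapping.lookup (Poly_Mapping.single k c * p) (k + m) = c * Poly_Mapping.lookup p m"
  by (simp add: lookup_mult lookup_single when_mult Sum_any_when_independent)

lemma lookup_single_times_outside:
  fixes p :: cpoly
  assumes "\<And>q. m \<noteq> k + q"
  shows "Poly_Mapping.lookup (Poly_Mapping.single k c * p) m = 0"
  using assms by (simp add: lookup_mult lookup_single when_mult Sum_any_when_independent)

lemma lookup_Const_times: "Poly_Mapping.lookup (Const c * p) m = c * Poly_Mapping.lookup p m"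
  using lookup_single_times[of 0 c p m] by (simp add: Const_def)

lemma lookup_X_times:
  "Poly_Mapping.lookup (X i * p) m =
    (if i \<in> Poly_Mapping.keys m then Poly_Mapping.lookup p (m - unit_expo i) else 0)"
proof (cases "i \<in> Poly_Mapping.keys m")
  case True
  then have "m = unit_expo i + (m - unit_expo i)" using diff_unit_add[of i m] by (simp add: add.commute)
  then show ?thesis using True lookup_single_times[of "unit_expo i" 1 p "m - unit_expo i"]
    by (simp add: X_def)
next
  case False
  then have "m \<noteq> unit_expo i + q" for q by (auto simp: in_keys_iff lookup_add)
  then show ?thesis using False lookup_single_times_outside[of m "unit_expo i" 1 p] by (simp add: X_def)
qed

lemma lookup_signed_X_times:
  "Poly_Mapping.lookup ((-1) ^ k * X i * p) m =
    (if i \<in> Poly_Mapping.keys m then (-1) ^ k * Poly_Mapping.lookup p (m - unit_expo i) else 0)"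
  by (cases "even k") (simp_all add: lookup_X_times)

lemma carrier_poly_ring:
  "p \<in> carrier (poly_ring n) \<longleftrightarrow> (\<forall>m. Poly_Mapping.lookup p m \<noteq> 0 \<longrightarrow> Poly_Mapping.keys m \<subseteq> {1..n})"
  by (auto simp: poly_ring_def in_keys_iff)

lemma poly_ring_simps [simp]:
  "mult (poly_ring n) = (*)" "one (poly_ring n) = 1" "zero (poly_ring n) = 0" "add (poly_ring n) = (+)"
  by (simp_all add: poly_ring_def)

lemma keys_add_nat: "Poly_Mapping.keys (a + b) = Poly_Mapping.keys a \<union> Poly_Mapping.keys (b :: expo)"
  by (auto simp: in_keys_iff lookup_add)

lemma mult_in_poly_ring:
  "p \<in> carrier (poly_ring n) \<Longrightarrow> q \<in> carrier (poly_ring n) \<Longrightarrow> p * q \<in> carrier (poly_ring n)"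
  using keys_mult[of p q] by (fastforce simp: poly_ring_def keys_add_nat)

lemma add_in_poly_ring:
  "p \<in> carrier (poly_ring n) \<Longrightarrow> q \<in> carrier (poly_ring n) \<Longrightarrow> p + q \<in> carrier (poly_ring n)"
  using Poly_Mapping.keys_add[of p q] by (auto simp: poly_ring_def)

lemma zero_in_poly_ring: "0 \<in> carrier (poly_ring n)"
  by (simp add: carrier_poly_ring)

lemma uminus_in_poly_ring: "p \<in> carrier (poly_ring n) \<Longrightarrow> - p \<in> carrier (poly_ring n)"
  by (simp add: carrier_poly_ring)

lemma Const_in_poly_ring: "Const c \<in> carrier (poly_ring n)"
  by (simp add: carrier_poly_ring Const_def lookup_single when_def)

lemma X_in_poly_ring: "i \<in> {1..n} \<Longrightarrow> X i \<in> carrier (poly_ring n)"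
  by (auto simp: carrier_poly_ring X_def lookup_single when_def)

lemma signed_X_in_poly_ring: "i \<in> {1..n} \<Longrightarrow> (-1) ^ k * X i \<in> carrier (poly_ring n)"
  by (cases "even k") (auto simp: X_in_poly_ring uminus_in_poly_ring)

lemma sum_in_poly_ring:
  "(\<And>i. i \<in> S \<Longrightarrow> p i \<in> carrier (poly_ring n)) \<Longrightarrow> sum p S \<in> carrier (poly_ring n)"
  by (induction S rule: infinite_finite_induct) (auto simp: zero_in_poly_ring add_in_poly_ring)

lemma poly_ring_cring: "cring (poly_ring n)"
proof (rule cringI)
  show "abelian_group (poly_ring n)"
  proof (rule abelian_groupI)
    fix p assume "p \<in> carrier (poly_ring n)"
    then show "\<exists>q\<in>carrier (poly_ring n). q \<oplus>\<^bsub>poly_ring n\<^esub> p = \<zero>\<^bsub>poly_ring n\<^esub>"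
      by (intro bexI[of _ "- p"]) (auto simp: uminus_in_poly_ring)
  qed (auto simp: add_in_poly_ring zero_in_poly_ring add_ac)
  show "comm_monoid (poly_ring n)"
  proof (rule comm_monoidI)
    show "\<one>\<^bsub>poly_ring n\<^esub> \<in> carrier (poly_ring n)"
      using Const_in_poly_ring[of 1] by (simp add: Const_def)
  qed (auto simp: mult_in_poly_ring mult_ac)
qed (simp add: distrib_right)

lemma prod_X: "(\<Prod>i\<in>B. X i) = Poly_Mapping.single (\<Sum>i\<in>B. unit_expo i) 1"
  by (induction B rule: infinite_finite_induct) (simp_all add: X_def mult_single)

context based_matroid
begin

definition monomial_ideal :: "cpoly set" where
  "monomial_ideal = {p \<in> carrier (poly_ring n).
    \<forall>m. Poly_Mapping.lookup p m \<noteq> 0 \<longrightarrow> spanning (Poly_Mapping.keys m)}"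

lemma ideal_monomial_ideal: "ideal monomial_ideal (poly_ring n)"
proof (rule idealI)
  interpret R: cring "poly_ring n" by (rule poly_ring_cring)
  show "ring (poly_ring n)" by (rule R.ring_axioms)
  have uminus: "\<ominus>\<^bsub>poly_ring n\<^esub> p = - p" if "p \<in> carrier (poly_ring n)" for p
    by (rule R.minus_equality) (use that in \<open>auto simp: uminus_in_poly_ring\<close>)
  have add: "p + q \<in> monomial_ideal" if "p \<in> monomial_ideal" "q \<in> monomial_ideal" for p q
    using that by (auto simp: monomial_ideal_def add_in_poly_ring lookup_add) (metis add_0)
  show "subgroup monomial_ideal (add_monoid (poly_ring n))"
  proof (rule R.add.subgroupI)
    show "monomial_ideal \<subseteq> carrier (poly_ring n)" by (auto simp: monomial_ideal_def)
    show "monomial_ideal \<noteq> {}"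
      using zero_in_poly_ring by (auto simp: monomial_ideal_def intro!: exI[of _ 0])
    show "\<ominus>\<^bsub>poly_ring n\<^esub> p \<in> monomial_ideal" if "p \<in> monomial_ideal" for p
      using that by (auto simp: monomial_ideal_def uminus uminus_in_poly_ring)
    show "p \<oplus>\<^bsub>poly_ring n\<^esub> q \<in> monomial_ideal" if "p \<in> monomial_ideal" "q \<in> monomial_ideal" for p q
      using add[OF that] by simp
  qed
  have mult: "q * p \<in> monomial_ideal" if p: "p \<in> monomial_ideal" and q: "q \<in> carrier (poly_ring n)" for p q
  proof -
    have "spanning (Poly_Mapping.keys m)" if "Poly_Mapping.lookup (q * p) m \<noteq> 0" for m
    proof -
      have "m \<in> Poly_Mapping.keys (q * p)" using that by (simp add: in_keys_iff)
      then obtain a b where ab: "m = a + b" "b \<in> Poly_Mapping.keys p"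
        using keys_mult[of q p] by auto
      have "spanning (Poly_Mapping.keys b)" using p ab(2) by (auto simp: monomial_ideal_def in_keys_iff)
      then show ?thesis by (rule spanning_mono) (simp add: ab(1) keys_add_nat)
    qed
    then show ?thesis using p q by (auto simp: monomial_ideal_def mult_in_poly_ring)
  qed
  show "q \<otimes>\<^bsub>poly_ring n\<^esub> p \<in> monomial_ideal" if "p \<in> monomial_ideal" "q \<in> carrier (poly_ring n)" for p q
    using mult[OF that] by simp
  show "p \<otimes>\<^bsub>poly_ring n\<^esub> q \<in> monomial_ideal" if "p \<in> monomial_ideal" "q \<in> carrier (poly_ring n)" for p q
    using mult[OF that] by (simp add: mult.commute)
qed

lemma diff_indicator_expo_add:
  assumes "B \<in> \<B>" "B \<subseteq> Poly_Mapping.keys m"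
  shows "(m - indicator_expo B) + indicator_expo B = m"
  using assms finite_basis[OF assms(1)]
  by (intro poly_mapping_eqI) (auto simp: lookup_add lookup_minus lookup_indicator_expo in_keys_iff Suc_le_eq)

lemma prod_X_in_monomial_ideal:
  assumes B: "B \<in> \<B>"
  shows "(\<Prod>i\<in>B. X i) \<in> monomial_ideal"
proof -
  have "Poly_Mapping.keys (indicator_expo B) = B" by (rule keys_indicator_expo[OF finite_basis[OF B]])
  then show ?thesis
    using basis_subset[OF B] B
    by (auto simp: monomial_ideal_def carrier_poly_ring prod_X lookup_single when_def spanning_def
        simp flip: indicator_expo_def)
qed

text \<open>A monomial with spanning support is a multiple of some generator, so a polynomial made
  of such monomials is generated term by term. The other inclusion is minimality of the generated
  ideal.\<close>

lemma basis_ideal_eq: "basis_ideal n \<B> = monomial_ideal"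
proof
  let ?G = "{\<Prod>i\<in>B. X i | B. B \<in> \<B>}"
  interpret R: cring "poly_ring n" by (rule poly_ring_cring)
  have G: "?G \<subseteq> monomial_ideal" using prod_X_in_monomial_ideal by auto
  then show "basis_ideal n \<B> \<subseteq> monomial_ideal"
    unfolding basis_ideal_def by (rule R.genideal_minimal[OF ideal_monomial_ideal])
  have GR: "?G \<subseteq> carrier (poly_ring n)" using G by (auto simp: monomial_ideal_def)
  interpret I: ideal "basis_ideal n \<B>" "poly_ring n"
    unfolding basis_ideal_def by (rule R.genideal_ideal[OF GR])
  have add: "p + q \<in> basis_ideal n \<B>" if "p \<in> basis_ideal n \<B>" "q \<in> basis_ideal n \<B>" for p q
    using I.a_closed[OF that] by simp
  have sum: "sum p S \<in> basis_ideal n \<B>" if "\<And>i. i \<in> S \<Longrightarrow> p i \<in> basis_ideal n \<B>"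
    for p :: "expo \<Rightarrow> cpoly" and S
    using that I.zero_closed by (induction S rule: infinite_finite_induct) (auto simp: add)
  show "monomial_ideal \<subseteq> basis_ideal n \<B>"
  proof
    fix p assume p: "p \<in> monomial_ideal"
    have "p = (\<Sum>m\<in>Poly_Mapping.keys p. Poly_Mapping.single m (Poly_Mapping.lookup p m))"
      by (rule poly_mapping_eqI) (auto simp: lookup_sum lookup_single when_def in_keys_iff)
    also have "\<dots> \<in> basis_ideal n \<B>"
    proof (rule sum)
      fix m assume m: "m \<in> Poly_Mapping.keys p"
      then have mn: "Poly_Mapping.keys m \<subseteq> {1..n}" and "spanning (Poly_Mapping.keys m)"
        using p by (auto simp: monomial_ideal_def carrier_poly_ring in_keys_iff)
      then obtain B where B: "B \<in> \<B>" "B \<subseteq> Poly_Mapping.keys m" by (auto simp: spanning_def)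
      let ?q = "Poly_Mapping.single (m - indicator_expo B) (Poly_Mapping.lookup p m) :: cpoly"
      have "(\<Prod>i\<in>B. X i) \<in> basis_ideal n \<B>"
        unfolding basis_ideal_def using R.genideal_self[OF GR] B(1) by auto
      moreover have "?q \<in> carrier (poly_ring n)"
        using mn by (auto simp: carrier_poly_ring lookup_single when_def in_keys_iff lookup_minus)
      ultimately have "?q * (\<Prod>i\<in>B. X i) \<in> basis_ideal n \<B>"
        using I.I_l_closed by simp
      then show "Poly_Mapping.single m (Poly_Mapping.lookup p m) \<in> basis_ideal n \<B>"
        using diff_indicator_expo_add[OF B] by (simp add: prod_X mult_single flip: indicator_expo_def)
    qed
    finally show "p \<in> basis_ideal n \<B>" .
  qed
qed

section \<open>Coefficients of elements of the face ring\<close>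

definition cls :: "cpoly \<Rightarrow> cpoly set" where
  "cls p = basis_ideal n \<B> +>\<^bsub>poly_ring n\<^esub> p"

text \<open>The choice by \<open>SOME\<close> is harmless: representatives of a class differ by an
  element of the ideal, which has no coefficients at the supports where the choice is read.\<close>

definition coef :: "cpoly set \<Rightarrow> expo \<Rightarrow> complex" where
  "coef a m = (if spanning (Poly_Mapping.keys m) then 0 else Poly_Mapping.lookup (SOME p. p \<in> a) m)"

lemma cls_eq: "cls p = {q + p | q. q \<in> monomial_ideal}"
  by (auto simp: cls_def basis_ideal_eq a_r_coset_def')

lemma coef_cls:
  "coef (cls p) m = (if spanning (Poly_Mapping.keys m) then 0 else Poly_Mapping.lookup p m)"
proof -
  have "0 \<in> monomial_ideal" by (simp add: monomial_ideal_def zero_in_poly_ring)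
  then have "p \<in> cls p" by (force simp: cls_eq)
  then have "(SOME q. q \<in> cls p) \<in> cls p" by (rule someI)
  then obtain q where "q \<in> monomial_ideal" "(SOME q. q \<in> cls p) = q + p" by (auto simp: cls_eq)
  then show ?thesis by (auto simp: coef_def monomial_ideal_def lookup_add)
qed

lemma cls_eqI:
  assumes "p \<in> carrier (poly_ring n)" "q \<in> carrier (poly_ring n)" "coef (cls p) = coef (cls q)"
  shows "cls p = cls q"
proof -
  have sub: "cls p' \<subseteq> cls q'" if p'q': "p' \<in> carrier (poly_ring n)" "q' \<in> carrier (poly_ring n)"
    "coef (cls p') = coef (cls q')" for p' q'
  proof
    fix x assume "x \<in> cls p'"
    then obtain i where i: "i \<in> monomial_ideal" "x = i + p'" by (auto simp: cls_eq)
    have "Poly_Mapping.lookup p' m = Poly_Mapping.lookup q' m" if "\<not> spanning (Poly_Mapping.keys m)" for m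
      using that fun_cong[OF p'q'(3), of m] by (simp add: coef_cls)
    then have "i + (p' - q') \<in> monomial_ideal"
      using i(1) p'q'(1,2) add_in_poly_ring[OF p'q'(1) uminus_in_poly_ring[OF p'q'(2)]]
      by (auto simp: monomial_ideal_def lookup_add lookup_minus intro: add_in_poly_ring)
    moreover have "x = (i + (p' - q')) + q'" using i(2) by simp
    ultimately show "x \<in> cls q'" unfolding cls_eq by blast
  qed
  show ?thesis using sub assms by (metis subset_antisym)
qed

lemma carrier_face_ring: "carrier (face_ring n \<B>) = cls ` carrier (poly_ring n)"
  by (auto simp: face_ring_def FactRing_def A_RCOSETS_def' cls_def)

interpretation I: ideal "basis_ideal n \<B>" "poly_ring n"
  unfolding basis_ideal_eq by (rule ideal_monomial_ideal)

lemma face_module_simps [simp]: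
  "carrier (face_module n \<B>) = carrier (face_ring n \<B>)"
  "add (face_module n \<B>) = add (face_ring n \<B>)"
  "zero (face_module n \<B>) = zero (face_ring n \<B>)"
  by (simp_all add: face_module_def)

interpretation A: abelian_group "face_module n \<B>"
proof -
  interpret R: ring "face_ring n \<B>"
    unfolding face_ring_def by (rule I.quotient_is_ring)
  show "abelian_group (face_module n \<B>)"
  proof (rule abelian_groupI)
    fix x assume "x \<in> carrier (face_module n \<B>)"
    then show "\<exists>y\<in>carrier (face_module n \<B>). y \<oplus>\<^bsub>face_module n \<B>\<^esub> x = \<zero>\<^bsub>face_module n \<B>\<^esub>"
      by (intro bexI[of _ "\<ominus>\<^bsub>face_ring n \<B>\<^esub> x"]) (simp_all add: R.l_neg)
  qed (simp_all add: R.a_ac)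
qed

lemma cls_zero: "\<zero>\<^bsub>face_ring n \<B>\<^esub> = cls 0"
  by (simp add: face_ring_def FactRing_def cls_eq basis_ideal_eq)

lemma cls_add:
  assumes "p \<in> carrier (poly_ring n)" "q \<in> carrier (poly_ring n)"
  shows "cls p \<oplus>\<^bsub>face_ring n \<B>\<^esub> cls q = cls (p + q)"
  using I.a_rcos_sum[OF assms] by (simp add: face_ring_def FactRing_def cls_def)

lemma cls_smult:
  assumes "p \<in> carrier (poly_ring n)" "q \<in> carrier (poly_ring n)"
  shows "p \<odot>\<^bsub>face_module n \<B>\<^esub> cls q = cls (p * q)"
  using I.rcoset_mult_add[OF assms] by (simp add: face_module_def face_ring_def FactRing_def cls_def)

lemma finsum_cls:
  assumes "finite S" "\<And>i. i \<in> S \<Longrightarrow> p i \<in> carrier (poly_ring n)"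
  shows "finsum (face_module n \<B>) (\<lambda>i. cls (p i)) S = cls (\<Sum>i\<in>S. p i)"
  using assms
proof (induction S)
  case (insert i S)
  have "finsum (face_module n \<B>) (\<lambda>i. cls (p i)) (insert i S) =
      cls (p i) \<oplus>\<^bsub>face_module n \<B>\<^esub> finsum (face_module n \<B>) (\<lambda>i. cls (p i)) S"
    by (rule A.finsum_insert) (use insert in \<open>auto simp: carrier_face_ring\<close>)
  then show ?case using insert by (simp add: cls_add sum_in_poly_ring)
qed (simp add: cls_zero)

section \<open>The Koszul complex in coordinates\<close>

definition coords :: "(nat set \<Rightarrow> cpoly set) \<Rightarrow> cochain" where
  "coords f = (\<lambda>m J. coef (f J) m)"

lemma coords_eqI:
  assumes "\<And>J. f J \<in> carrier (face_ring n \<B>)" "\<And>J. g J \<in> carrier (face_ring n \<B>)"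
    "coords f = coords g"
  shows "f = g"
proof
  fix J
  obtain p q where pq: "p \<in> carrier (poly_ring n)" "f J = cls p" "q \<in> carrier (poly_ring n)" "g J = cls q"
    using assms(1,2)[of J] by (auto simp: carrier_face_ring)
  have "coef (f J) = coef (g J)" using assms(3) by (auto simp: coords_def fun_eq_iff)
  then show "f J = g J" using cls_eqI[OF pq(1,3)] pq(2,4) by simp
qed

lemma coef_add:
  assumes "a \<in> carrier (face_ring n \<B>)" "b \<in> carrier (face_ring n \<B>)"
  shows "coef (a \<oplus>\<^bsub>face_ring n \<B>\<^esub> b) m = coef a m + coef b m"
  using assms by (auto simp: carrier_face_ring cls_add coef_cls lookup_add)

lemma coef_smult_Const:
  assumes "a \<in> carrier (face_ring n \<B>)"
  shows "coef (Const c \<odot>\<^bsub>face_module n \<B>\<^esub> a) m = c * coef a m"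
  using assms
  by (auto simp: carrier_face_ring cls_smult Const_in_poly_ring coef_cls lookup_Const_times)

lemma coef_zero [simp]: "coef \<zero>\<^bsub>face_ring n \<B>\<^esub> m = 0"
  by (simp add: cls_zero coef_cls)

lemma koszul_d_cls:
  assumes "\<And>J. p J \<in> carrier (poly_ring n)"
  shows "koszul_d n (face_module n \<B>) (\<lambda>J. cls (p J)) J =
    cls (\<Sum>i\<in>{1..n} - J. (-1) ^ (card {j\<in>J. j < i} + 1) * X i * p (insert i J))"
    and "(\<Sum>i\<in>{1..n} - J. (-1) ^ (card {j\<in>J. j < i} + 1) * X i * p (insert i J)) \<in> carrier (poly_ring n)"
proof -
  let ?q = "\<lambda>i. (-1) ^ (card {j\<in>J. j < i} + 1) * X i * p (insert i J)"
  have c: "?q i \<in> carrier (poly_ring n)" if "i \<in> {1..n} - J" for i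
    using that by (intro mult_in_poly_ring signed_X_in_poly_ring assms) auto
  have "koszul_d n (face_module n \<B>) (\<lambda>J. cls (p J)) J =
      finsum (face_module n \<B>) (\<lambda>i. cls (?q i)) ({1..n} - J)"
    unfolding koszul_d_def
  proof (rule A.finsum_cong'[OF refl])
    show "(\<lambda>i. cls (?q i)) \<in> {1..n} - J \<rightarrow> carrier (face_module n \<B>)"
      unfolding face_module_simps carrier_face_ring by (intro Pi_I imageI c)
  qed (intro cls_smult signed_X_in_poly_ring assms, auto)
  also have "\<dots> = cls (\<Sum>i\<in>{1..n} - J. ?q i)" by (rule finsum_cls) (use c in auto)
  finally show "koszul_d n (face_module n \<B>) (\<lambda>J. cls (p J)) J = cls (\<Sum>i\<in>{1..n} - J. ?q i)" .
  show "(\<Sum>i\<in>{1..n} - J. ?q i) \<in> carrier (poly_ring n)" by (rule sum_in_poly_ring) (use c in auto)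
qed

text \<open>The bridge between the coset complex and the cochains: in coordinates its differential
  becomes \<open>qd\<close>.\<close>

lemma koszul_d_coords:
  assumes "\<And>J. f J \<in> carrier (face_ring n \<B>)"
  shows "coords (koszul_d n (face_module n \<B>) f) = qd (coords f)"
    and "koszul_d n (face_module n \<B>) f J \<in> carrier (face_ring n \<B>)"
proof -
  have "\<forall>J. \<exists>p. p \<in> carrier (poly_ring n) \<and> f J = cls p" using assms by (auto simp: carrier_face_ring)
  then obtain p where p: "\<And>J. p J \<in> carrier (poly_ring n)" "\<And>J. f J = cls (p J)" by metis
  have f: "f = (\<lambda>J. cls (p J))" using p(2) by auto
  show "koszul_d n (face_module n \<B>) f J \<in> carrier (face_ring n \<B>)"
    unfolding f koszul_d_cls(1)[of p, OF p(1)] carrier_face_ring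
    by (rule imageI) (rule koszul_d_cls(2)[of p, OF p(1)])
  show "coords (koszul_d n (face_module n \<B>) f) = qd (coords f)"
  proof (intro ext)
    fix m J
    show "coords (koszul_d n (face_module n \<B>) f) m J = qd (coords f) m J"
    proof (cases "spanning (Poly_Mapping.keys m)")
      case True
      then show ?thesis by (simp add: coords_def coef_def qd_def)
    next
      case False
      \<comment> \<open>Divisors of a monomial off the ideal stay off it, so \<open>coef\<close>
        cuts none of the coefficients below to zero.\<close>
      have ns: "\<not> spanning (Poly_Mapping.keys (m - unit_expo i))" for i
        using False spanning_mono[of "Poly_Mapping.keys (m - unit_expo i)" "Poly_Mapping.keys m"]
        by (auto simp: keys_diff_unit split: if_splits)
      have "coords (koszul_d n (face_module n \<B>) f) m J =
          (\<Sum>i\<in>{1..n} - J. if i \<in> Poly_Mapping.keys m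
            then koszul_sign i J * coords f (m - unit_expo i) (insert i J) else 0)"
        unfolding f coords_def koszul_d_cls(1)[of p, OF p(1)] using False ns
        by (simp only: coef_cls lookup_sum lookup_signed_X_times koszul_sign_def if_False)
      also have "\<dots> = qd (coords f) m J"
        using False by (simp add: qd_def kd_def sum.inter_restrict)
      finally show ?thesis .
    qed
  qed
qed

text \<open>Ensures that each slice of a chain at a fixed \<open>J\<close> is finitely supported,
  hence a polynomial.\<close>

lemma finite_expos: "finite {m. Poly_Mapping.keys m \<subseteq> {1..n} \<and> expo_deg m = s}"
proof (rule finite_imageD)
  let ?M = "{m :: expo. Poly_Mapping.keys m \<subseteq> {1..n} \<and> expo_deg m = s}"
  show "inj_on Poly_Mapping.lookup ?M" by (simp add: inj_on_def poly_mapping.lookup_inject)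
  have "Poly_Mapping.lookup m i \<le> s" if m: "m \<in> ?M" for m i
  proof (cases "i \<in> Poly_Mapping.keys m")
    case True
    then have "Poly_Mapping.lookup m i \<le> expo_deg m"
      unfolding expo_deg_def by (intro member_le_sum) auto
    then show ?thesis using m by simp
  qed (simp add: in_keys_iff)
  then have "Poly_Mapping.lookup ` ?M \<subseteq> {f. \<forall>i. (i \<in> {1..n} \<longrightarrow> f i \<in> {..s}) \<and> (i \<notin> {1..n} \<longrightarrow> f i = 0)}"
    by (auto simp: in_keys_iff)
  then show "finite (Poly_Mapping.lookup ` ?M)"
    by (rule finite_subset) (intro finite_set_of_finite_funs; simp)
qed

abbreviation face_space :: "nat \<Rightarrow> nat \<Rightarrow> (complex, nat set \<Rightarrow> cpoly set) module" where
  "face_space s t \<equiv> koszul_space n (face_module n \<B>) (face_piece n \<B>) s t"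

lemma homogeneous_iff: "homogeneous s p \<longleftrightarrow> (\<forall>m. Poly_Mapping.lookup p m \<noteq> 0 \<longrightarrow> expo_deg m = s)"
  by (auto simp: homogeneous_def expo_deg_def in_keys_iff)

lemma face_piece_eq:
  "face_piece n \<B> s = cls ` {p \<in> carrier (poly_ring n). homogeneous s p}"
  by (auto simp: face_piece_def cls_def)

lemma face_space_carrier_iff:
  "f \<in> carrier (face_space s t) \<longleftrightarrow>
    (\<forall>J. f J \<in> (if J \<subseteq> {1..n} \<and> card J = t then face_piece n \<B> s else {cls 0}))"
  by (simp add: koszul_space_def cls_zero)

lemma face_space_values:
  assumes "f \<in> carrier (face_space s t)"
  shows "f J \<in> carrier (face_ring n \<B>)"
  using assms[unfolded face_space_carrier_iff, rule_format, of J] zero_in_poly_ring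
  by (auto simp: carrier_face_ring face_piece_eq split: if_splits)

lemma face_space_coords:
  assumes f: "f \<in> carrier (face_space s t)"
  shows "chain n s (s + t) (coords f)" "off_ideal (coords f)"
proof -
  show "off_ideal (coords f)" by (simp add: off_ideal_def supported_def coords_def coef_def)
  show "chain n s (s + t) (coords f)"
    unfolding chain_def supported_def
  proof (intro allI impI)
    fix m J assume nz: "coords f m J \<noteq> 0"
    have J: "J \<subseteq> {1..n} \<and> card J = t"
    proof (rule ccontr)
      assume "\<not> ?thesis"
      then have "f J = cls 0" using f[unfolded face_space_carrier_iff, rule_format, of J] by (simp split: if_split_asm)
      then show False using nz by (simp add: coords_def coef_cls split: if_splits)
    qed
    then obtain p where p: "p \<in> carrier (poly_ring n)" "homogeneous s p" "f J = cls p"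
      using f[unfolded face_space_carrier_iff, rule_format, of J] by (auto simp: face_piece_eq)
    have "Poly_Mapping.lookup p m \<noteq> 0" using nz p(3) by (simp add: coords_def coef_cls split: if_splits)
    then show "Poly_Mapping.keys m \<subseteq> {1..n} \<and> J \<subseteq> {1..n} \<and> expo_deg m = s \<and> s + card J = s + t"
      using p(1,2) J by (simp add: carrier_poly_ring homogeneous_iff)
  qed
qed

lemma face_space_coords_surj:
  assumes g: "chain n s (s + t) g" "off_ideal g"
  obtains f where "f \<in> carrier (face_space s t)" "coords f = g"
proof -
  define p where "p J = Abs_poly_mapping (\<lambda>m. g m J)" for J
  have gD: "Poly_Mapping.keys m \<subseteq> {1..n} \<and> J \<subseteq> {1..n} \<and> expo_deg m = s \<and> s + card J = s + t"
    if "g m J \<noteq> 0" for m J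
    using supportedD[OF g(1)[unfolded chain_def] that] .
  have "finite {m. g m J \<noteq> 0}" for J
    by (rule finite_subset[OF _ finite_expos[of s]]) (rule subsetI, drule CollectD, drule gD, simp)
  then have lookup: "Poly_Mapping.lookup (p J) m = g m J" for J m by (simp add: p_def)
  have pR: "p J \<in> carrier (poly_ring n)" "homogeneous s (p J)" for J
    using gD by (auto simp: carrier_poly_ring homogeneous_iff lookup)
  \<comment> \<open>Away from the basis vectors of exterior degree \<open>t\<close> the Koszul space
    demands the value zero.\<close>
  have p0: "p J = 0" if "\<not> (J \<subseteq> {1..n} \<and> card J = t)" for J
  proof (rule poly_mapping_eqI)
    fix m show "Poly_Mapping.lookup (p J) m = Poly_Mapping.lookup 0 m"
    proof (rule ccontr)
      assume "\<not> ?thesis"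
      then have "g m J \<noteq> 0" by (simp add: lookup)
      from gD[OF this] that show False by simp
    qed
  qed
  show ?thesis
  proof (rule that[of "\<lambda>J. cls (p J)"])
    show "(\<lambda>J. cls (p J)) \<in> carrier (face_space s t)"
      using pR p0 by (auto simp: face_space_carrier_iff face_piece_eq)
    show "coords (\<lambda>J. cls (p J)) = g"
      using g(2) by (auto simp: coords_def coef_cls lookup off_ideal_def supported_def fun_eq_iff)
  qed
qed

section \<open>Dimensions of Tor\<close>

abbreviation face_tor :: "nat \<Rightarrow> nat \<Rightarrow> (complex, (nat set \<Rightarrow> cpoly set) set) module" where
  "face_tor t s \<equiv> Tor n (face_module n \<B>) (face_piece n \<B>) t s"

abbreviation face_cycles :: "nat \<Rightarrow> nat \<Rightarrow> (nat set \<Rightarrow> cpoly set) set" where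
  "face_cycles s t \<equiv> koszul_cycles n (face_module n \<B>) (face_piece n \<B>) s t"

abbreviation face_boundaries :: "nat \<Rightarrow> nat \<Rightarrow> (nat set \<Rightarrow> cpoly set) set" where
  "face_boundaries s t \<equiv> koszul_boundaries n (face_module n \<B>) (face_piece n \<B>) s t"

lemma zero_in_face_ring: "\<zero>\<^bsub>face_ring n \<B>\<^esub> \<in> carrier (face_ring n \<B>)"
  by (simp add: cls_zero carrier_face_ring zero_in_poly_ring)

lemma coords_zero: "coords (\<lambda>J. \<zero>\<^bsub>face_ring n \<B>\<^esub>) = (\<lambda>m J. 0)"
  by (simp add: coords_def)

lemma face_cycles_iff:
  "f \<in> face_cycles s t \<longleftrightarrow> f \<in> carrier (face_space s t) \<and> qd (coords f) = (\<lambda>m J. 0)"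
proof -
  have "koszul_d n (face_module n \<B>) f = (\<lambda>J. \<zero>\<^bsub>face_ring n \<B>\<^esub>) \<longleftrightarrow> qd (coords f) = (\<lambda>m J. 0)"
    if "f \<in> carrier (face_space s t)"
    using coords_eqI[of "koszul_d n (face_module n \<B>) f" "\<lambda>J. \<zero>\<^bsub>face_ring n \<B>\<^esub>"]
      koszul_d_coords[of f, OF face_space_values[OF that]] zero_in_face_ring coords_zero by auto
  then show ?thesis by (auto simp: koszul_cycles_def)
qed

lemma qd_chain:
  assumes "pre_chain n s d h"
  shows "chain n s d (qd h)" "off_ideal (qd h)"
  using chain_kd[OF assms] by (auto simp: chain_def off_ideal_def supported_def qd_def)

text \<open>\<open>pre_chain\<close> at \<open>s = 0\<close> contains only zero, so one formula
  covers both the separate clause for \<open>s = 0\<close> and the image of the differential for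
  \<open>s > 0\<close>.\<close>

lemma face_boundaries_iff:
  "f \<in> face_boundaries s t \<longleftrightarrow> f \<in> carrier (face_space s t) \<and>
    (\<exists>h. pre_chain n s (s + t) h \<and> off_ideal h \<and> coords f = qd h)"
proof (cases s)
  case 0
  have qd0: "qd (\<lambda>m J. 0) = (\<lambda>m J. 0)" by (simp add: qd_def fun_eq_iff)
  have zero: "(\<lambda>J. \<zero>\<^bsub>face_ring n \<B>\<^esub>) \<in> carrier (face_space 0 t)"
    using zero_in_poly_ring by (auto simp: face_space_carrier_iff cls_zero face_piece_eq homogeneous_iff)
  have bnd: "f \<in> face_boundaries 0 t \<longleftrightarrow> f = (\<lambda>J. \<zero>\<^bsub>face_ring n \<B>\<^esub>)"
    by (simp add: koszul_boundaries_def)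
  have pre: "(\<exists>h. pre_chain n 0 (0 + t) h \<and> off_ideal h \<and> coords f = qd h) \<longleftrightarrow> coords f = (\<lambda>m J. 0)"
    by (simp add: pre_chain_0 off_ideal_def supported_def qd0)
  show ?thesis
    unfolding 0 bnd pre
  proof
    assume f: "f \<in> carrier (face_space 0 t) \<and> coords f = (\<lambda>m J. 0)"
    show "f = (\<lambda>J. \<zero>\<^bsub>face_ring n \<B>\<^esub>)"
      by (rule coords_eqI) (use f face_space_values[of f 0 t] zero_in_face_ring coords_zero in simp_all)
  qed (simp add: zero coords_zero)
next
  case (Suc s')
  show ?thesis
  proof
    assume "f \<in> face_boundaries s t"
    then obtain h where h: "h \<in> carrier (face_space s' (Suc t))" "f = koszul_d n (face_module n \<B>) h"
      by (auto simp: koszul_boundaries_def Suc)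
    have pre: "pre_chain n s (s + t) (coords h)"
      using face_space_coords(1)[OF h(1)] by (simp add: Suc pre_chain_Suc)
    have f: "coords f = qd (coords h)" "\<And>J. f J \<in> carrier (face_ring n \<B>)"
      using koszul_d_coords[of h, OF face_space_values[OF h(1)]] h(2) by auto
    \<comment> \<open>That \<open>f\<close> has the right degrees is seen indirectly: a genuine
      element of the space has the same coordinates, and coordinates are injective.\<close>
    obtain f' where f': "f' \<in> carrier (face_space s t)" "coords f' = qd (coords h)"
      by (rule face_space_coords_surj[OF qd_chain[OF pre]])
    have "f = f'"
      by (rule coords_eqI) (use f f' face_space_values in auto)
    then show "f \<in> carrier (face_space s t) \<and>
        (\<exists>h. pre_chain n s (s + t) h \<and> off_ideal h \<and> coords f = qd h)"
      using f' pre face_space_coords(2)[OF h(1)] by auto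
  next
    assume "f \<in> carrier (face_space s t) \<and>
        (\<exists>h. pre_chain n s (s + t) h \<and> off_ideal h \<and> coords f = qd h)"
    then obtain h where f: "f \<in> carrier (face_space s t)"
      and h: "chain n s' (s' + Suc t) h" "off_ideal h" "coords f = qd h"
      by (auto simp: Suc pre_chain_Suc)
    obtain h' where h': "h' \<in> carrier (face_space s' (Suc t))" "coords h' = h"
      by (rule face_space_coords_surj[OF h(1,2)])
    have "f = koszul_d n (face_module n \<B>) h'"
      by (rule coords_eqI)
        (use koszul_d_coords[of h', OF face_space_values[OF h'(1)]] f h(3) h'(2) face_space_values in auto)
    then show "f \<in> face_boundaries s t" using h'(1) by (auto simp: koszul_boundaries_def Suc)
  qed
qed

section \<open>Linear structure of the cycles\<close>

lemma face_space_ops: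
  "add (face_space s t) = (\<lambda>f g J. f J \<oplus>\<^bsub>face_ring n \<B>\<^esub> g J)"
  "smult (face_space s t) = (\<lambda>c f J. Const c \<odot>\<^bsub>face_module n \<B>\<^esub> f J)"
  by (simp_all add: koszul_space_def)

lemma qd_add: "qd (\<lambda>m J. f m J + g m J) = (\<lambda>m J. qd f m J + qd g m J)"
  by (auto simp: qd_def kd_add fun_eq_iff)

lemma qd_scale: "qd (\<lambda>m J. c * f m J) = (\<lambda>m J. c * qd f m J)"
  by (auto simp: qd_def kd_scale fun_eq_iff)

lemma in_face_cyclesI:
  assumes "\<And>J. f J \<in> carrier (face_ring n \<B>)"
    "chain n s (s + t) (coords f)" "off_ideal (coords f)" "qd (coords f) = (\<lambda>m J. 0)"
  shows "f \<in> face_cycles s t"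
proof -
  obtain f' where f': "f' \<in> carrier (face_space s t)" "coords f' = coords f"
    by (rule face_space_coords_surj[OF assms(2,3)])
  have "f = f'" by (rule coords_eqI) (use assms(1) f' face_space_values in auto)
  then show ?thesis using f'(1) assms(4) by (simp add: face_cycles_iff)
qed

lemma face_cycles_add:
  assumes f: "f \<in> face_cycles s t" and g: "g \<in> face_cycles s t"
  shows "coords (\<lambda>J. f J \<oplus>\<^bsub>face_ring n \<B>\<^esub> g J) = (\<lambda>m J. coords f m J + coords g m J)"
    and "(\<lambda>J. f J \<oplus>\<^bsub>face_ring n \<B>\<^esub> g J) \<in> face_cycles s t"
proof -
  have fg: "f \<in> carrier (face_space s t)" "g \<in> carrier (face_space s t)"
    "qd (coords f) = (\<lambda>m J. 0)" "qd (coords g) = (\<lambda>m J. 0)"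
    using f g by (auto simp: face_cycles_iff)
  show co: "coords (\<lambda>J. f J \<oplus>\<^bsub>face_ring n \<B>\<^esub> g J) = (\<lambda>m J. coords f m J + coords g m J)"
    unfolding coords_def
    using coef_add[OF face_space_values[OF fg(1)] face_space_values[OF fg(2)]] by simp
  show "(\<lambda>J. f J \<oplus>\<^bsub>face_ring n \<B>\<^esub> g J) \<in> face_cycles s t"
  proof (rule in_face_cyclesI, unfold co)
    fix J
    have "f J \<in> carrier (face_ring n \<B>)" "g J \<in> carrier (face_ring n \<B>)"
      using fg face_space_values by auto
    then show "f J \<oplus>\<^bsub>face_ring n \<B>\<^esub> g J \<in> carrier (face_ring n \<B>)"
      by (auto simp: carrier_face_ring cls_add add_in_poly_ring)
  next
    show "chain n s (s + t) (\<lambda>m J. coords f m J + coords g m J)"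
      using face_space_coords(1)[OF fg(1)] face_space_coords(1)[OF fg(2)]
      unfolding chain_def supported_def by (metis add_0)
    show "off_ideal (\<lambda>m J. coords f m J + coords g m J)"
      using face_space_coords(2)[OF fg(1)] face_space_coords(2)[OF fg(2)]
      unfolding off_ideal_def supported_def by (metis add_0)
    show "qd (\<lambda>m J. coords f m J + coords g m J) = (\<lambda>m J. 0)"
      by (simp add: qd_add fg)
  qed
qed

lemma face_cycles_smult:
  assumes f: "f \<in> face_cycles s t"
  shows "coords (\<lambda>J. Const c \<odot>\<^bsub>face_module n \<B>\<^esub> f J) = (\<lambda>m J. c * coords f m J)"
    and "(\<lambda>J. Const c \<odot>\<^bsub>face_module n \<B>\<^esub> f J) \<in> face_cycles s t"
proof -
  have f': "f \<in> carrier (face_space s t)" "qd (coords f) = (\<lambda>m J. 0)"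
    using f by (auto simp: face_cycles_iff)
  show co: "coords (\<lambda>J. Const c \<odot>\<^bsub>face_module n \<B>\<^esub> f J) = (\<lambda>m J. c * coords f m J)"
    unfolding coords_def using coef_smult_Const[OF face_space_values[OF f'(1)]] by simp
  show "(\<lambda>J. Const c \<odot>\<^bsub>face_module n \<B>\<^esub> f J) \<in> face_cycles s t"
  proof (rule in_face_cyclesI, unfold co)
    fix J
    have "f J \<in> carrier (face_ring n \<B>)" using f' face_space_values by auto
    then show "Const c \<odot>\<^bsub>face_module n \<B>\<^esub> f J \<in> carrier (face_ring n \<B>)"
      by (auto simp: carrier_face_ring cls_smult Const_in_poly_ring mult_in_poly_ring)
  next
    show "chain n s (s + t) (\<lambda>m J. c * coords f m J)"
      using face_space_coords(1)[OF f'(1)]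
      unfolding chain_def supported_def by (metis mult_zero_right)
    show "off_ideal (\<lambda>m J. c * coords f m J)"
      using face_space_coords(2)[OF f'(1)] by (simp add: off_ideal_def supported_def)
    show "qd (\<lambda>m J. c * coords f m J) = (\<lambda>m J. 0)"
      by (simp add: qd_scale f')
  qed
qed

text \<open>Reduces Tor to cochains: \<open>ker\<close> and \<open>bound\<close> make the boundaries
  the common kernel of the functionals \<open>\<Phi>\<close> on the cycles, and \<open>surj\<close>
  makes these functionals independent.\<close>

lemma dim_Tor:
  fixes \<Phi> :: "cochain \<Rightarrow> 'c \<Rightarrow> complex"
  assumes \<Phi>_add: "\<And>f g x. \<Phi> (\<lambda>m J. f m J + g m J) x = \<Phi> f x + \<Phi> g x"
    and \<Phi>_scale: "\<And>c f x. \<Phi> (\<lambda>m J. c * f m J) x = c * \<Phi> f x"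
    and C: "finite C"
    and ker: "\<And>f. chain n s (s + t) f \<Longrightarrow> off_ideal f \<Longrightarrow> qd f = (\<lambda>m J. 0) \<Longrightarrow>
      (\<forall>x\<in>C. \<Phi> f x = 0) \<Longrightarrow> \<exists>h. pre_chain n s (s + t) h \<and> off_ideal h \<and> f = qd h"
    and bound: "\<And>h. pre_chain n s (s + t) h \<Longrightarrow> off_ideal h \<Longrightarrow>
      qd (qd h) = (\<lambda>m J. 0) \<and> (\<forall>x\<in>C. \<Phi> (qd h) x = 0)"
    and surj: "\<And>v. \<exists>f. chain n s (s + t) f \<and> off_ideal f \<and> qd f = (\<lambda>m J. 0) \<and> (\<forall>x\<in>C. \<Phi> f x = v x)"
  shows "vectorspace.dim class_ring (face_tor t s) = card C"
  unfolding Tor_def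
proof (rule dim_quot_module[where \<iota> = "\<lambda>f (m, J). coords f m J" and \<phi> = "\<lambda>f. \<Phi> (coords f)"])
  let ?M = "face_space s t\<lparr>carrier := face_cycles s t\<rparr>"
  show "f \<oplus>\<^bsub>?M\<^esub> g \<in> carrier ?M" if "f \<in> carrier ?M" "g \<in> carrier ?M" for f g
    using face_cycles_add(2) that by (simp add: face_space_ops)
  show "c \<odot>\<^bsub>?M\<^esub> f \<in> carrier ?M" if "f \<in> carrier ?M" for c f
    using face_cycles_smult(2) that by (simp add: face_space_ops)
  show "inj_on (\<lambda>f (m, J). coords f m J) (carrier ?M)"
  proof (rule inj_onI)
    fix f g assume fg: "f \<in> carrier ?M" "g \<in> carrier ?M"
      and eq: "(\<lambda>(m, J). coords f m J) = (\<lambda>(m, J). coords g m J)"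
    have "coords f m J = coords g m J" for m J using fun_cong[OF eq, of "(m, J)"] by simp
    then show "f = g"
      using fg by (intro coords_eqI) (auto simp: face_cycles_iff intro: face_space_values)
  qed
  show "(case x of (m, J) \<Rightarrow> coords (f \<oplus>\<^bsub>?M\<^esub> g) m J) =
      (case x of (m, J) \<Rightarrow> coords f m J) + (case x of (m, J) \<Rightarrow> coords g m J)"
    if "f \<in> carrier ?M" "g \<in> carrier ?M" for f g x
    using face_cycles_add(1)[of f s t g] that by (simp add: face_space_ops split: prod.split)
  show "(case x of (m, J) \<Rightarrow> coords (c \<odot>\<^bsub>?M\<^esub> f) m J) = c * (case x of (m, J) \<Rightarrow> coords f m J)"
    if "f \<in> carrier ?M" for c f x
    using face_cycles_smult(1)[of f s t c] that by (simp add: face_space_ops split: prod.split)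
  show "\<Phi> (coords (f \<oplus>\<^bsub>?M\<^esub> g)) x = \<Phi> (coords f) x + \<Phi> (coords g) x"
    if "f \<in> carrier ?M" "g \<in> carrier ?M" for f g x
    using face_cycles_add(1)[of f s t g] that by (simp add: face_space_ops \<Phi>_add)
  show "\<Phi> (coords (c \<odot>\<^bsub>?M\<^esub> f)) x = c * \<Phi> (coords f) x" if "f \<in> carrier ?M" for c f x
    using face_cycles_smult(1)[of f s t c] that by (simp add: face_space_ops \<Phi>_scale)
  show "finite C" by (fact C)
  show "face_boundaries s t = {f \<in> carrier ?M. \<forall>x\<in>C. \<Phi> (coords f) x = 0}"
  proof (intro equalityI subsetI)
    fix f assume "f \<in> face_boundaries s t"
    then obtain h where h: "f \<in> carrier (face_space s t)" "pre_chain n s (s + t) h" "off_ideal h"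
      "coords f = qd h" by (auto simp: face_boundaries_iff)
    then show "f \<in> {f \<in> carrier ?M. \<forall>x\<in>C. \<Phi> (coords f) x = 0}"
      using bound[OF h(2,3)] by (simp add: face_cycles_iff)
  next
    fix f assume f: "f \<in> {f \<in> carrier ?M. \<forall>x\<in>C. \<Phi> (coords f) x = 0}"
    then have fs: "f \<in> carrier (face_space s t)" "qd (coords f) = (\<lambda>m J. 0)"
      by (auto simp: face_cycles_iff)
    show "f \<in> face_boundaries s t"
      using ker[OF face_space_coords[OF fs(1)] fs(2)] f fs(1) by (simp add: face_boundaries_iff)
  qed
  show "\<exists>f\<in>carrier ?M. \<forall>x\<in>C. \<Phi> (coords f) x = v x" for v
  proof -
    obtain g where g: "chain n s (s + t) g" "off_ideal g" "qd g = (\<lambda>m J. 0)" "\<forall>x\<in>C. \<Phi> g x = v x"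
      using surj[of v] by blast
    obtain f where "f \<in> carrier (face_space s t)" "coords f = g"
      by (rule face_space_coords_surj[OF g(1,2)])
    then show ?thesis using g(3,4) by (intro bexI[of _ f]) (simp_all add: face_cycles_iff)
  qed
qed

text \<open>Truncating in between loses nothing, since at a monomial off the ideal only divisors off
  the ideal are read.\<close>

lemma qd_qd:
  assumes "pre_chain n s d h"
  shows "qd (qd h) = (\<lambda>m J. 0)"
proof (intro ext)
  fix m J
  show "qd (qd h) m J = 0"
  proof (cases "spanning (Poly_Mapping.keys m)")
    case False
    have "kd n (qd h) m J = kd n (kd n h) m J"
      unfolding kd_def[of n "qd h"] kd_def[of n "kd n h"]
    proof (intro sum.cong refl)
      fix i
      have "\<not> spanning (Poly_Mapping.keys (m - unit_expo i))"
        using False spanning_mono[of "Poly_Mapping.keys (m - unit_expo i)" "Poly_Mapping.keys m"]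
        by (auto simp: keys_diff_unit split: if_splits)
      then show "koszul_sign i J * qd h (m - unit_expo i) (insert i J) =
          koszul_sign i J * kd n h (m - unit_expo i) (insert i J)" by (simp add: qd_def)
    qed
    then show ?thesis using kd_kd_chain[OF assms] by (simp add: qd_def)
  qed (simp add: qd_def)
qed

lemma dim_Tor_off_rank:
  assumes "s + t > 0" "Suc s \<noteq> matroid_rank \<B>"
  shows "vectorspace.dim class_ring (face_tor t s) = 0"
proof -
  have "vectorspace.dim class_ring (face_tor t s) = card ({} :: unit set)"
  proof (rule dim_Tor[where \<Phi> = "\<lambda>f x. 0"])
    show "\<exists>f. chain n s (s + t) f \<and> off_ideal f \<and> qd f = (\<lambda>m J. 0) \<and> (\<forall>x\<in>{}. (0::complex) = v x)"
      for v :: "unit \<Rightarrow> complex"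
      by (rule exI[of _ "\<lambda>m J. 0"]) (simp add: chain_def off_ideal_def supported_def qd_def fun_eq_iff)
  qed (use quotient_exact assms qd_qd in auto)
  then show ?thesis by simp
qed

text \<open>The functionals are the critical values of the connecting map
  \<open>f \<mapsto> kd n f\<close>.\<close>

lemma dim_Tor_rank:
  assumes "s + t > 0" "Suc s = matroid_rank \<B>"
  shows "vectorspace.dim class_ring (face_tor t s) = card (crit_cells t)"
proof (rule dim_Tor[where \<Phi> = "\<lambda>f (m, J). kd n f m J"])
  fix f assume f: "chain n s (s + t) f" "off_ideal f" "qd f = (\<lambda>m J. 0)"
    and zero: "\<forall>x\<in>crit_cells t. (case x of (m, J) \<Rightarrow> kd n f m J) = 0"
  show "\<exists>h. pre_chain n s (s + t) h \<and> off_ideal h \<and> f = qd h"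
  proof (rule quotient_rank_kernel[OF f assms])
    fix m J assume c: "critical m J"
    show "kd n f m J = 0"
    proof (cases "Suc (card J) = t")
      case True
      then show ?thesis using zero c by (auto simp: crit_cells_def)
    next
      case False
      \<comment> \<open>\<open>kd n f\<close> has exterior degree \<open>t - 1\<close>, so it
        vanishes at critical cells of any other size.\<close>
      then show ?thesis using chain_Suc_kd[OF f(1)] by (auto simp: chain_def supported_def)
    qed
  qed
next
  fix h assume h: "pre_chain n s (s + t) h" "off_ideal h"
  \<comment> \<open>In degree \<open>s = r - 1\<close> nothing is truncated, so boundaries of the
    quotient are true boundaries and the next differential kills them.\<close>
  have "\<not> spanning (Poly_Mapping.keys m)" if "kd n h m J \<noteq> 0" for m J
    using supportedD[OF chain_kd[OF h(1), unfolded chain_def] that] rank_le_expo_deg[of m] assms(2)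
    by auto
  then have "qd h = kd n h" by (auto simp: qd_def fun_eq_iff)
  then show "qd (qd h) = (\<lambda>m J. 0) \<and> (\<forall>x\<in>crit_cells t. (case x of (m, J) \<Rightarrow> kd n (qd h) m J) = 0)"
    using qd_qd[OF h(1)] kd_kd_chain[OF h(1)] by auto
next
  fix v :: "expo \<times> nat set \<Rightarrow> complex"
  define c where "c m J = (if (m, J) \<in> crit_cells t then v (m, J) else 0)" for m J
  have c: "chain n (matroid_rank \<B>) (s + t) c" "supported critical c"
    using assms(2) critical_expo_deg(1)
    by (auto simp: chain_def supported_def c_def crit_cells_def critical_def cell_def)
  obtain f where f: "chain n s (s + t) f" "off_ideal f" "qd f = (\<lambda>m J. 0)"
    "\<And>m J. critical m J \<Longrightarrow> kd n f m J = c m J"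
    by (rule quotient_rank_surj[OF c assms]) blast
  then show "\<exists>f. chain n s (s + t) f \<and> off_ideal f \<and> qd f = (\<lambda>m J. 0) \<and>
      (\<forall>x\<in>crit_cells t. (case x of (m, J) \<Rightarrow> kd n f m J) = v x)"
    by (intro exI[of _ f]) (auto simp: c_def crit_cells_def)
qed (auto simp: kd_add kd_scale finite_crit_cells split: prod.split)

text \<open>The class of \<open>1\<close>, where the Koszul complex of the polynomial ring fails to
  be exact. Positive rank keeps \<open>1\<close> out of the ideal.\<close>

lemma dim_Tor_0_0:
  assumes "matroid_rank \<B> > 0"
  shows "vectorspace.dim class_ring (face_tor 0 0) = 1"
proof -
  have ns: "\<not> spanning {}" using assms rank_le_expo_deg[of 0] by (auto simp: expo_deg_def)
  have supp: "m = 0 \<and> J = {}" if "chain n 0 0 f" "f m J \<noteq> 0" for f m J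
  proof -
    have *: "J \<subseteq> {1..n}" "expo_deg m = 0" "card J = 0"
      using that by (auto simp: chain_def supported_def)
    have "finite J" using *(1) finite_subset by blast
    moreover have "m = 0"
    proof (rule ccontr)
      assume "m \<noteq> 0"
      then obtain i where "i \<in> Poly_Mapping.keys m" by fastforce
      then show False using expo_deg_diff_unit[of i m] *(2) by simp
    qed
    ultimately show ?thesis using *(3) by simp
  qed
  have "vectorspace.dim class_ring (face_tor 0 0) = card {()}"
  proof (rule dim_Tor[where \<Phi> = "\<lambda>f _. f 0 {}"])
    fix f assume f: "chain n 0 (0 + 0) f" "\<forall>x\<in>{()}. f 0 {} = 0"
    then have "f = (\<lambda>m J. 0)" using supp[of f] by (auto simp: fun_eq_iff)
    then show "\<exists>h. pre_chain n 0 (0 + 0) h \<and> off_ideal h \<and> f = qd h"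
      by (intro exI[of _ "\<lambda>m J. 0"]) (simp add: pre_chain_0 off_ideal_def supported_def qd_def fun_eq_iff)
  next
    fix v :: "unit \<Rightarrow> complex"
    let ?f = "\<lambda>(m :: expo) (J :: nat set). if m = 0 \<and> J = {} then v () else 0"
    have "?f (m - unit_expo i) (insert i J) = 0" for m i J by simp
    then have "qd ?f = (\<lambda>m J. 0)" by (simp add: qd_def kd_def fun_eq_iff)
    moreover have "chain n 0 (0 + 0) ?f" "off_ideal ?f"
      using ns by (auto simp: chain_def off_ideal_def supported_def expo_deg_def)
    ultimately show "\<exists>f. chain n 0 (0 + 0) f \<and> off_ideal f \<and> qd f = (\<lambda>m J. 0) \<and> (\<forall>x\<in>{()}. f 0 {} = v x)"
      by (intro exI[of _ ?f]) simp
  next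
    fix h assume "pre_chain n 0 (0 + 0) h"
    then show "qd (qd h) = (\<lambda>m J. 0) \<and> (\<forall>x\<in>{()}. qd h 0 {} = 0)"
      by (simp add: pre_chain_0 qd_def fun_eq_iff kd_def)
  qed simp_all
  then show ?thesis by simp
qed

end

section \<open>Comparison of the generating functions\<close>

lemma fps_one_plus_X_power_nth: "fps_nth ((1 + fps_X) ^ k :: rat fps) t = of_nat (k choose t)"
proof -
  have "(1 + fps_X) ^ k = (\<Sum>i\<le>k. of_nat (k choose i) * fps_X ^ i :: rat fps)"
    using binomial_ring[of "fps_X :: rat fps" 1 k] by (simp add: add.commute)
  then show ?thesis
    by (simp add: fps_sum_nth fps_X_power_iff flip: fps_of_nat)
      (simp add: if_distrib sum.delta binomial_eq_0 not_le cong: if_cong)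
qed

theorem theorem3p9:
  fixes n r :: nat and \<B> :: "nat set set"
  assumes "matroid_on n \<B>" and "matroid_rank \<B> = r" and "r \<ge> 1"
  shows "Tor_Hilb n (face_module n \<B>) (face_piece n \<B>) - 1 =
    (let x = (fps_X :: rat fps); y = (fps_X :: rat fps fps) in
      fps_const (x * (1 + x) ^ (n - r)) * y ^ (r - 1) * fps_const (tutte n \<B> 1 (inverse (1 + x))))"
proof -
  interpret based_matroid n \<B> by unfold_locales (fact assms(1))
  let ?x = "fps_X :: rat fps"
  have inv: "(1 + ?x) * inverse (1 + ?x) = 1"
    by (rule inverse_mult_eq_1') simp
  \<comment> \<open>The exponent \<open>n - r\<close> splits into passive and active elements of
    \<open>B\<close>; the inverse powers cancel the active part.\<close>
  have shift: "(1 + ?x) ^ (n - r) * inverse (1 + ?x) ^ ext_activity n \<B> B = (1 + ?x) ^ card (passives B)"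
    if B: "B \<in> \<B>" for B
  proof -
    have "(1 + ?x) ^ (n - r) * inverse (1 + ?x) ^ ext_activity n \<B> B =
        (1 + ?x) ^ card (passives B) * ((1 + ?x) * inverse (1 + ?x)) ^ ext_activity n \<B> B"
      using card_passives[OF B] assms(2) by (simp add: power_mult_distrib mult.assoc flip: power_add)
    then show ?thesis by (simp add: inv)
  qed
  define P where "P = ?x * (\<Sum>B\<in>\<B>. (1 + ?x) ^ card (passives B))"
  have poly: "?x * (1 + ?x) ^ (n - r) * tutte n \<B> 1 (inverse (1 + ?x)) = P"
    unfolding tutte_def P_def using shift by (simp add: sum_distrib_left mult.assoc cong: sum.cong)
  \<comment> \<open>The factor \<open>x\<close> turns \<open>t\<close> into \<open>t - 1\<close>,
    matching the size of \<open>J\<close> in a critical cell counted by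
    \<open>crit_cells t\<close>.\<close>
  have coeff: "fps_nth P t = of_nat (card (crit_cells t))" for t
    by (simp add: P_def card_crit_cells fps_sum_nth fps_one_plus_X_power_nth)
  have dim: "vectorspace.dim class_ring (face_tor t s) =
      (if s = 0 \<and> t = 0 then 1 else if Suc s = r then card (crit_cells t) else 0)" for s t
    using dim_Tor_0_0 dim_Tor_rank[of s t] dim_Tor_off_rank[of s t] assms(2,3) by auto
  \<comment> \<open>For \<open>r = 1\<close> the bidegree of the class of \<open>1\<close> lies in
    the row \<open>s = r - 1\<close>; this count makes both descriptions agree after 1 is
    subtracted.\<close>
  have crit0: "card (crit_cells 0) = 0" by (simp add: card_crit_cells)
  show ?thesis
    unfolding Let_def
  proof (intro fps_ext)
    fix s t
    have "fps_nth (fps_nth (Tor_Hilb n (face_module n \<B>) (face_piece n \<B>) - 1) s) t =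
        (if Suc s = r then of_nat (card (crit_cells t)) else 0)"
      using crit0 by (auto simp: Tor_Hilb_def dim)
    also have "\<dots> = fps_nth (fps_nth (fps_const (?x * (1 + ?x) ^ (n - r)) * fps_X ^ (r - 1) *
        fps_const (tutte n \<B> 1 (inverse (1 + ?x)))) s) t"
    proof -
      have eq: "fps_const (?x * (1 + ?x) ^ (n - r)) * fps_X ^ (r - 1) *
          fps_const (tutte n \<B> 1 (inverse (1 + ?x))) = fps_const P * fps_X ^ (r - 1)"
        by (simp only: poly[symmetric] fps_const_mult[symmetric] mult_ac)
      show ?thesis
        unfolding eq using assms(3) by (auto simp: fps_X_power_mult_right_nth coeff)
    qed
    finally show "fps_nth (fps_nth (Tor_Hilb n (face_module n \<B>) (face_piece n \<B>) - 1) s) t =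
        fps_nth (fps_nth (fps_const (?x * (1 + ?x) ^ (n - r)) * fps_X ^ (r - 1) *
        fps_const (tutte n \<B> 1 (inverse (1 + ?x)))) s) t" .
  qed
qed

end
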